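(* Let $f\colon S^2\to S^2$ be an expanding Thurston map, let $\mathcal C\subseteq S^2$ be a Jordan curve containing $\operatorname{post} f$ with $f^{n_{\mathcal C}}(\mathcal C)\subseteq\mathcal C$ for some $n_{\mathcal C}\in\mathbb N$, let $d$ be a visual metric on $S^2$ for $f$, let $\alpha\in(0,1]$, and let $\phi\in\operatorname{Lip}(S^2,d^\alpha)$. Let $C_1>1$ be a constant, depending only on $f$, $d$, $\mathcal C$, and $\alpha$, such that $\mathcal L_\psi^n(u)\in\operatorname{Lip}(S^2,d^\alpha)$ and $|\mathcal L_\psi^n(u)|_{d^\alpha}\le C_1(|\psi|_{d^\alpha}+|u|_{d^\alpha})$ for all $\psi,u\in\operatorname{Lip}(S^2,d^\alpha)$ and $n\in\mathbb N$ (such a constant exists). Then the function $u_\phi\colon S^2\to\mathbb R$ given by $$u_\phi(x)=\limsup_{n\to+\infty}\mathcal L_{\overline\phi}^n(0)(x),\qquad x\in S^2,$$ where $0$ denotes the zero function, satisfies: (i) $|u_\phi(x)|\le 2C_1|\phi|_{d^\alpha}\operatorname{diam}_d(S^2)^\alpha$ for each $x\in S^2$; (ii) $u_\phi\in\operatorname{Lip}(S^2,d^\alpha)$ with $|u_\phi|_{d^\alpha}\le C_1|\phi|_{d^\alpha}$; (iii) $\mathcal L_{\overline\phi}(u_\phi)=u_\phi$.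
   Context: For a continuous function $\psi\colon S^2\to\mathbb R$, the Bousch operator $\mathcal L_\psi\colon\mathbb R^{S^2}\to\mathbb R^{S^2}$ for $f$ is $\mathcal L_\psi(u)(x)=\max\{\psi(y)+u(y):y\in f^{-1}(x)\}$ ($f$ is finite-to-one and surjective), and $\mathcal L_\psi^n$ is its $n$-th iterate. $\overline\phi=\phi-Q(f,\phi)$, where $Q(f,\phi)=\max_\mu\int\phi\,d\mu$ over all $f$-invariant Borel probability measures $\mu$ on $S^2$. $|\psi|_{d^\alpha}=\sup_{x\ne y}|\psi(x)-\psi(y)|/d(x,y)^\alpha$, and $\operatorname{Lip}(S^2,d^\alpha)$ is the space of real-valued functions $\psi$ on $S^2$ with $|\psi|_{d^\alpha}<\infty$. $\mathbb N=\{1,2,\dots\}$, $\mathbb N_0=\mathbb N\cup\{0\}$. $S^2$ is an oriented topological $2$-sphere. A continuous map $f\colon S^2\to S^2$ is a branched covering map if near each $x\in S^2$, in suitable orientation-preserving local homeomorphic coordinates sending $x$ and $f(x)$ to $0\in\mathbb C$, it has the form $z\mapsto z^k$ with $k=\deg_f(x)\in\mathbb N$. Put $\operatorname{crit} f=\{x:\deg_f(x)\ge 2\}$ and $\operatorname{post} f=\{f^n(x): x\in\operatorname{crit} f,\ n\in\mathbb N\}$. A Thurston map is a branched covering map of topological degree $\ge 2$ with $\operatorname{post} f$ finite. For a Jordan curve $\mathcal C\subseteq S^2$ with $\operatorname{post} f\subseteq\mathcal C$ and $n\in\mathbb N_0$: the $n$-tiles are the closures of the connected components of $S^2\setminus f^{-n}(\mathcal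 C)$; the $n$-edges are the closures of the connected components of $f^{-n}(\mathcal C)\setminus f^{-n}(\operatorname{post} f)$; the $n$-vertices are the points of $f^{-n}(\operatorname{post} f)$; the $n$-cells are the $n$-tiles, the $n$-edges, and the singletons $\{v\}$ with $v$ an $n$-vertex. A Thurston map $f$ is expanding if for some (equivalently, every) metric inducing the topology of $S^2$ and some (equivalently, every) Jordan curve $\mathcal C\supseteq\operatorname{post} f$, the maximal diameter of $n$-tiles tends to $0$ as $n\to+\infty$. A metric $d$ on $S^2$ is a visual metric for an expanding Thurston map $f$ with expansion factor $\Lambda>1$ if for some (equivalently, every) Jordan curve $\mathcal C\supseteq\operatorname{post} f$ there is $C\ge1$ such that for all $n\in\mathbb N_0$: $d(\sigma,\tau)\ge C^{-1}\Lambda^{-n}$ for all disjoint $n$-cells $\sigma,\tau$, and $C^{-1}\Lambda^{-n}\le\operatorname{diam}_d(\tau)\le C\Lambda^{-n}$ for all $n$-edges and $n$-tiles $\tau$. *)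

theory Defs
  imports
    "HOL-Complex_Analysis.Complex_Analysis"
    "HOL-Homology.Homology"
    "HOL-Probability.Probability"
begin

section \<open>Oriented topological 2-spheres\<close>

text \<open>The sphere is a whole type \<open>'a\<close> whose topology is homeomorphic to the unit sphere of
  \<open>\<real>\<^sup>3\<close>. An orientation is an atlas of complex charts with orientation-preserving transition
  maps. A homeomorphism between open subsets of the plane preserves orientation iff the image of
  every small positively oriented circle winds once around the image of its centre.\<close>

definition orientation_preserving_on :: "complex set \<Rightarrow> (complex \<Rightarrow> complex) \<Rightarrow> bool" where
  "orientation_preserving_on W h \<longleftrightarrow>
     (\<forall>z\<in>W. \<forall>r>0. cball z r \<subseteq> W \<longrightarrow> winding_number (h \<circ> circlepath z r) (h z) = 1)"

type_synonym 'a chart = "'a set \<times> ('a \<Rightarrow> complex)"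

definition is_chart :: "'a::topological_space chart \<Rightarrow> bool" where
  "is_chart c \<longleftrightarrow> (case c of (U, p) \<Rightarrow>
     open U \<and> open (p ` U) \<and> (\<exists>q. homeomorphism U (p ` U) p q))"

definition compatible_charts :: "'a chart \<Rightarrow> 'a chart \<Rightarrow> bool" where
  "compatible_charts c c' \<longleftrightarrow> (case c of (U, p) \<Rightarrow> case c' of (V, q) \<Rightarrow>
     orientation_preserving_on (p ` (U \<inter> V)) (q \<circ> inv_into U p))"

definition oriented_sphere :: "'a::topological_space chart set \<Rightarrow> bool" where
  "oriented_sphere \<A> \<longleftrightarrow>
     (UNIV :: 'a set) homeomorphic sphere (0 :: real^3) 1 \<and>
     (\<forall>c\<in>\<A>. is_chart c) \<and> (\<Union>c\<in>\<A>. fst c) = UNIV \<and>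
     (\<forall>c\<in>\<A>. \<forall>c'\<in>\<A>. compatible_charts c c')"

text \<open>The orientation-preserving local homeomorphic coordinates: all charts that are compatible
  with the given atlas, not only the charts in it.\<close>

definition oriented_chart :: "'a::topological_space chart set \<Rightarrow> 'a chart \<Rightarrow> bool" where
  "oriented_chart \<A> c \<longleftrightarrow> is_chart c \<and> (\<forall>c'\<in>\<A>. compatible_charts c c')"

section \<open>Thurston maps\<close>

definition has_local_degree ::
  "'a::topological_space chart set \<Rightarrow> ('a \<Rightarrow> 'a) \<Rightarrow> 'a \<Rightarrow> nat \<Rightarrow> bool" where
  "has_local_degree \<A> f x k \<longleftrightarrow> k \<ge> 1 \<and>
     (\<exists>U p V q. oriented_chart \<A> (U, p) \<and> x \<in> U \<and> p x = 0 \<and>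
                oriented_chart \<A> (V, q) \<and> f x \<in> V \<and> q (f x) = 0 \<and>
                f ` U \<subseteq> V \<and> (\<forall>y\<in>U. q (f y) = p y ^ k))"

definition local_degree ::
  "'a::topological_space chart set \<Rightarrow> ('a \<Rightarrow> 'a) \<Rightarrow> 'a \<Rightarrow> nat" where
  "local_degree \<A> f x = (THE k. has_local_degree \<A> f x k)"

definition branched_covering ::
  "'a::topological_space chart set \<Rightarrow> ('a \<Rightarrow> 'a) \<Rightarrow> bool" where
  "branched_covering \<A> f \<longleftrightarrow>
     continuous_on UNIV f \<and> (\<forall>x. \<exists>k. has_local_degree \<A> f x k)"

definition crit :: "'a::topological_space chart set \<Rightarrow> ('a \<Rightarrow> 'a) \<Rightarrow> 'a set" where
  "crit \<A> f = {x. local_degree \<A> f x \<ge> 2}"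

definition post :: "'a::topological_space chart set \<Rightarrow> ('a \<Rightarrow> 'a) \<Rightarrow> 'a set" where
  "post \<A> f = {(f ^^ n) x | x n. x \<in> crit \<A> f \<and> n \<ge> 1}"

text \<open>The Brouwer degree in the library is defined for self-maps of \<^term>\<open>nsphere 2\<close>, so the map is
  conjugated by a homeomorphism; the degree does not depend on its choice.\<close>

definition topological_degree :: "('a::topological_space \<Rightarrow> 'a) \<Rightarrow> int" where
  "topological_degree f =
     (THE k. \<forall>h g. homeomorphic_maps (euclidean :: 'a topology) (nsphere 2) h g \<longrightarrow>
                   Brouwer_degree2 2 (h \<circ> f \<circ> g) = k)"

definition Thurston_map ::
  "'a::topological_space chart set \<Rightarrow> ('a \<Rightarrow> 'a) \<Rightarrow> bool" where
  "Thurston_map \<A> f \<longleftrightarrow>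
     branched_covering \<A> f \<and> topological_degree f \<ge> 2 \<and> finite (post \<A> f)"

section \<open>Cells, expansion and visual metrics\<close>

definition Jordan_curve :: "'a::topological_space set \<Rightarrow> bool" where
  "Jordan_curve C \<longleftrightarrow> C homeomorphic sphere (0 :: complex) 1"

definition n_tiles :: "('a::topological_space \<Rightarrow> 'a) \<Rightarrow> 'a set \<Rightarrow> nat \<Rightarrow> 'a set set" where
  "n_tiles f C n = closure ` components (UNIV - (f ^^ n) -` C)"

definition n_edges ::
  "'a::topological_space chart set \<Rightarrow> ('a \<Rightarrow> 'a) \<Rightarrow> 'a set \<Rightarrow> nat \<Rightarrow> 'a set set" where
  "n_edges \<A> f C n = closure ` components ((f ^^ n) -` C - (f ^^ n) -` post \<A> f)"

definition n_vertices ::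
  "'a::topological_space chart set \<Rightarrow> ('a \<Rightarrow> 'a) \<Rightarrow> nat \<Rightarrow> 'a set" where
  "n_vertices \<A> f n = (f ^^ n) -` post \<A> f"

definition n_cells ::
  "'a::topological_space chart set \<Rightarrow> ('a \<Rightarrow> 'a) \<Rightarrow> 'a set \<Rightarrow> nat \<Rightarrow> 'a set set" where
  "n_cells \<A> f C n =
     n_tiles f C n \<union> n_edges \<A> f C n \<union> (\<lambda>v. {v}) ` n_vertices \<A> f n"

text \<open>Diameter and distance with respect to an explicit metric; the diameter is only meaningful
  for nonempty bounded sets.\<close>

definition diam :: "('a \<Rightarrow> 'a \<Rightarrow> real) \<Rightarrow> 'a set \<Rightarrow> real" where
  "diam d A = Sup {d x y | x y. x \<in> A \<and> y \<in> A}"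

definition set_distance :: "('a \<Rightarrow> 'a \<Rightarrow> real) \<Rightarrow> 'a set \<Rightarrow> 'a set \<Rightarrow> real" where
  "set_distance d A B = Inf {d x y | x y. x \<in> A \<and> y \<in> B}"

text \<open>For each \<open>n\<close> there are only finitely many \<open>n\<close>-tiles, so the maximum below is a genuine one.\<close>

definition expanding ::
  "'a::topological_space chart set \<Rightarrow> ('a \<Rightarrow> 'a) \<Rightarrow> bool" where
  "expanding \<A> f \<longleftrightarrow>
     (\<exists>\<rho> C. Metric_space UNIV \<rho> \<and> Metric_space.mtopology UNIV \<rho> = euclidean \<and>
            Jordan_curve C \<and> post \<A> f \<subseteq> C \<and>
            (\<lambda>n. Max (diam \<rho> ` n_tiles f C n)) \<longlonglongrightarrow> 0)"

text \<open>The metric is not required to induce the topology. Boundedness of the edges and tiles is part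
  of the upper bound on their diameters.\<close>

definition visual_metric_factor ::
  "'a::topological_space chart set \<Rightarrow> ('a \<Rightarrow> 'a) \<Rightarrow> ('a \<Rightarrow> 'a \<Rightarrow> real) \<Rightarrow> real \<Rightarrow> bool" where
  "visual_metric_factor \<A> f d \<Lambda> \<longleftrightarrow>
     Metric_space UNIV d \<and> \<Lambda> > 1 \<and>
     (\<exists>C. Jordan_curve C \<and> post \<A> f \<subseteq> C \<and>
       (\<exists>K\<ge>1. \<forall>n.
          (\<forall>\<sigma>\<in>n_cells \<A> f C n. \<forall>\<tau>\<in>n_cells \<A> f C n.
             \<sigma> \<inter> \<tau> = {} \<longrightarrow> set_distance d \<sigma> \<tau> \<ge> 1 / (K * \<Lambda> ^ n)) \<and>
          (\<forall>\<tau>\<in>n_edges \<A> f C n \<union> n_tiles f C n.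
             Metric_space.mbounded UNIV d \<tau> \<and>
             1 / (K * \<Lambda> ^ n) \<le> diam d \<tau> \<and> diam d \<tau> \<le> K / \<Lambda> ^ n)))"

definition visual_metric ::
  "'a::topological_space chart set \<Rightarrow> ('a \<Rightarrow> 'a) \<Rightarrow> ('a \<Rightarrow> 'a \<Rightarrow> real) \<Rightarrow> bool" where
  "visual_metric \<A> f d \<longleftrightarrow> (\<exists>\<Lambda>. visual_metric_factor \<A> f d \<Lambda>)"

section \<open>Lipschitz functions for the snowflake metric\<close>

definition difference_quotients ::
  "('a \<Rightarrow> 'a \<Rightarrow> real) \<Rightarrow> real \<Rightarrow> ('a \<Rightarrow> real) \<Rightarrow> real set" where
  "difference_quotients d \<alpha> \<psi> = {\<bar>\<psi> x - \<psi> y\<bar> / d x y powr \<alpha> | x y. x \<noteq> y}"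

definition Lip :: "('a \<Rightarrow> 'a \<Rightarrow> real) \<Rightarrow> real \<Rightarrow> ('a \<Rightarrow> real) set" where
  "Lip d \<alpha> = {\<psi>. bdd_above (difference_quotients d \<alpha> \<psi>)}"

definition lip_seminorm :: "('a \<Rightarrow> 'a \<Rightarrow> real) \<Rightarrow> real \<Rightarrow> ('a \<Rightarrow> real) \<Rightarrow> real" where
  "lip_seminorm d \<alpha> \<psi> = Sup (difference_quotients d \<alpha> \<psi>)"

section \<open>Maximal ergodic averages and the Bousch operator\<close>

definition invariant_measures :: "('a::topological_space \<Rightarrow> 'a) \<Rightarrow> 'a measure set" where
  "invariant_measures f = {\<mu>. prob_space \<mu> \<and> sets \<mu> = sets borel \<and> distr \<mu> borel f = \<mu>}"

definition max_average :: "('a::topological_space \<Rightarrow> 'a) \<Rightarrow> ('a \<Rightarrow> real) \<Rightarrow> real" where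
  "max_average f \<phi> = (GREATEST q. \<exists>\<mu>\<in>invariant_measures f. q = (\<integral>x. \<phi> x \<partial>\<mu>))"

definition normalised ::
  "('a::topological_space \<Rightarrow> 'a) \<Rightarrow> ('a \<Rightarrow> real) \<Rightarrow> 'a \<Rightarrow> real" where
  "normalised f \<phi> = (\<lambda>x. \<phi> x - max_average f \<phi>)"

definition bousch :: "('a \<Rightarrow> 'a) \<Rightarrow> ('a \<Rightarrow> real) \<Rightarrow> ('a \<Rightarrow> real) \<Rightarrow> 'a \<Rightarrow> real" where
  "bousch f \<psi> u = (\<lambda>x. Max {\<psi> y + u y | y. y \<in> f -` {x}})"

text \<open>The upper limit is taken in the extended reals. The real-valued version is only meaningful
  where that limit is finite.\<close>

definition bousch_limsup ::
  "('a::topological_space \<Rightarrow> 'a) \<Rightarrow> ('a \<Rightarrow> real) \<Rightarrow> 'a \<Rightarrow> ereal" where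
  "bousch_limsup f \<phi> x =
     limsup (\<lambda>n. ereal ((bousch f (normalised f \<phi>) ^^ n) (\<lambda>_. 0) x))"

definition u_fun :: "('a::topological_space \<Rightarrow> 'a) \<Rightarrow> ('a \<Rightarrow> real) \<Rightarrow> 'a \<Rightarrow> real" where
  "u_fun f \<phi> x = real_of_ereal (bousch_limsup f \<phi> x)"

end

theory Submission
  imports Defs
begin

text \<open>Write \<open>\<psi> = \<phi> - Q\<close> with \<open>Q = Q(f, \<phi>)\<close>, and \<open>u\<^sub>n\<close> for the \<open>n\<close>-th Bousch iterate of \<open>0\<close> with weight \<open>\<psi>\<close>.
  Unfolding the recursion, \<open>u\<^sub>n x\<close> is the maximum of the Birkhoff sums \<open>\<psi> y + \<dots> + \<psi> (f\<^sup>n\<^sup>-\<^sup>1 y)\<close> over all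
  \<open>y\<close> with \<open>f\<^sup>n y = x\<close>. The assumed estimate says that the \<open>u\<^sub>n\<close> are uniformly Hoelder, so each of
  them oscillates by at most \<open>B = C\<^sub>1 |\<phi>| diam\<^sup>\<alpha>\<close>. To bound \<open>u\<^sub>n\<close> itself by \<open>B\<close> it therefore
  suffices that \<open>u\<^sub>n\<close> is neither positive everywhere nor negative everywhere, and here the
  normalisation by \<open>Q\<close> enters.

  Not everywhere negative: some point has \<open>n\<close>-th Birkhoff sum of \<open>\<phi>\<close> at least \<open>n Q\<close>, since the
  integral of this sum against a maximising measure equals \<open>n Q\<close>. Not everywhere positive: if
  \<open>u\<^sub>n \<ge> \<epsilon> > 0\<close> everywhere, preimages can be chained to produce orbit pieces of length \<open>k n\<close> along
  which \<open>\<phi>\<close> has average at least \<open>Q + \<epsilon> / n\<close>; a limit of the empirical measures on these pieces is an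
  invariant measure with integral at least \<open>Q + \<epsilon> / n\<close>, contradicting the maximality of \<open>Q\<close>.
  Both arguments rest on \<open>invariant_measure_of_orbit_averages\<close>, which also shows that the maximum
  \<open>Q\<close> is attained (\<open>max_average_birkhoff\<close>).

  Once the \<open>u\<^sub>n\<close> are bounded, their upper limit is finite and inherits the bound and the Hoelder
  estimate. It is a fixed point because the upper limit of a maximum of finitely many sequences
  is the maximum of the upper limits (\<open>bousch_fixed_point_of_limsup\<close>).

  Two preparations are needed. Limits of empirical measures are obtained from the compactness of
  tight families of distributions on the real line: a space-filling curve \<open>[0, 1] \<rightarrow> S\<^sup>2\<close> has a
  section, along which empirical measures are lifted to \<open>[0, 1]\<close>, and the limit there is
  pushed forward by the curve. And \<open>\<phi>\<close> has to be continuous for the topology of the sphere. This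
  holds because the finitely many \<open>n\<close>-tiles cover the sphere, so that the \<open>n\<close>-tiles containing a
  point form a neighbourhood of it, of small diameter for a visual metric. Finiteness of the set of
  tiles follows from the Jordan curve theorem together with the fact that a branched covering is an
  open map with finite fibres.\<close>

section \<open>A space-filling curve on the sphere\<close>

definition binary_digit :: "real \<Rightarrow> nat \<Rightarrow> real" where
  "binary_digit a k = of_int (\<lfloor>2 ^ Suc k * a\<rfloor> - 2 * \<lfloor>2 ^ k * a\<rfloor>)"

lemma binary_digit_cases: "binary_digit a k = 0 \<or> binary_digit a k = 1"
proof -
  have "\<lfloor>2 * (2 ^ k * a)\<rfloor> - 2 * \<lfloor>2 ^ k * a\<rfloor> \<in> {0, 1}"
    by (auto, linarith+)
  then show ?thesis
    by (auto simp: binary_digit_def mult.assoc)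
qed

lemma binary_digit_sums:
  assumes "0 \<le> a" "a < 1"
  shows "(\<lambda>k. binary_digit a k / 2 ^ Suc k) sums a"
proof -
  have partial: "(\<Sum>k<n. binary_digit a k / 2 ^ Suc k) = of_int \<lfloor>2 ^ n * a\<rfloor> / 2 ^ n" for n
  proof (induction n)
    case 0
    have "\<lfloor>a\<rfloor> = 0"
      using assms by linarith
    then show ?case
      by simp
  next
    case (Suc n)
    then show ?case
      by (simp add: binary_digit_def field_simps)
  qed
  have "(\<lambda>n. (1 / 2) ^ n :: real) \<longlonglongrightarrow> 0"
    by (rule LIMSEQ_realpow_zero) auto
  then have low: "(\<lambda>n. a - (1 / 2) ^ n) \<longlonglongrightarrow> a"
    using tendsto_diff[OF tendsto_const[of a]] by fastforce
  have "(\<lambda>n. of_int \<lfloor>2 ^ n * a\<rfloor> / 2 ^ n) \<longlonglongrightarrow> a"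
  proof (rule tendsto_sandwich[OF _ _ low tendsto_const]; intro always_eventually allI)
    fix n
    have "2 ^ n * a - 1 \<le> of_int \<lfloor>2 ^ n * a\<rfloor>"
      by linarith
    then have "(2 ^ n * a - 1) / 2 ^ n \<le> of_int \<lfloor>2 ^ n * a\<rfloor> / 2 ^ n"
      by (intro divide_right_mono) auto
    then show "a - (1 / 2) ^ n \<le> of_int \<lfloor>2 ^ n * a\<rfloor> / 2 ^ n"
      by (simp add: field_simps)
    show "of_int \<lfloor>2 ^ n * a\<rfloor> / 2 ^ n \<le> a"
      by (simp add: field_simps)
  qed
  then show ?thesis
    unfolding sums_def partial .
qed

text \<open>Any continuous function of period \<open>2\<close> that vanishes on \<open>[0, 1/3]\<close> and equals \<open>1\<close> on \<open>[2/3, 1]\<close> would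
  do in Schoenberg's construction. Truncating \<open>1/2 - cos (\<pi> t)\<close> gives one without case distinctions,
  because \<open>cos (\<pi> / 3) = 1/2\<close> and \<open>cos (2 \<pi> / 3) = -1/2\<close>.\<close>

definition schoenberg_wave :: "real \<Rightarrow> real" where
  "schoenberg_wave t = max 0 (min 1 (1 / 2 - cos (pi * t)))"

lemma schoenberg_wave_bounds: "0 \<le> schoenberg_wave t" "schoenberg_wave t \<le> 1"
  by (auto simp: schoenberg_wave_def)

lemma continuous_schoenberg_wave: "continuous_on A schoenberg_wave"
  unfolding schoenberg_wave_def by (intro continuous_intros)

lemma schoenberg_wave_reads_digit:
  assumes e: "e = 0 \<or> e = 1" and r: "0 \<le> r" "r \<le> 1 / 3"
  shows "schoenberg_wave (2 * of_int m + 2 * e / 3 + r) = e"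
proof -
  define s where "s = 2 * e / 3 + r"
  have "cos (pi * (2 * of_int m + s)) = cos (pi * s + 2 * pi * of_int m)"
    by (simp add: algebra_simps)
  also have "\<dots> = cos (pi * s)"
    by (simp add: cos_add cos_int_2pin sin_int_2pin)
  finally have per: "schoenberg_wave (2 * of_int m + s) = max 0 (min 1 (1 / 2 - cos (pi * s)))"
    by (simp add: schoenberg_wave_def)
  from e have "max 0 (min 1 (1 / 2 - cos (pi * s))) = e"
  proof
    assume [simp]: "e = 0"
    have "cos (pi / 3) \<le> cos (pi * s)"
      using r by (intro cos_monotone_0_pi_le) (auto simp: s_def)
    then show ?thesis
      by (simp add: cos_60)
  next
    assume [simp]: "e = 1"
    have "cos (pi * s) \<le> cos (2 * pi / 3)"
      using r by (intro cos_monotone_0_pi_le) (auto simp: s_def field_simps)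
    then show ?thesis
      by (simp add: cos_120)
  qed
  with per show ?thesis
    by (simp add: s_def add.assoc)
qed

lemma ternary_digits_bounds:
  assumes e: "\<And>j. e j = 0 \<or> e j = (1::real)"
  shows "summable (\<lambda>j. 2 * e j / 3 ^ Suc j)"
    and "0 \<le> (suminf (\<lambda>j. 2 * e j / 3 ^ Suc j))" and "(suminf (\<lambda>j. 2 * e j / 3 ^ Suc j)) \<le> 1"
proof -
  have e': "0 \<le> e j" "e j \<le> 1" for j
    using e[of j] by auto
  have geo: "(\<lambda>j. 2 / 3 * (1 / 3) ^ j :: real) sums (2 / 3 * (1 / (1 - 1 / 3)))"
    by (intro sums_mult geometric_sums) auto
  have le: "2 * e j / 3 ^ Suc j \<le> 2 / 3 * (1 / 3) ^ j" for j
    using e'[of j] by (simp add: field_simps)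
  show sm: "summable (\<lambda>j. 2 * e j / 3 ^ Suc j)"
    by (rule summable_comparison_test'[OF sums_summable[OF geo], of 0])
       (use le e' in \<open>auto simp: abs_mult\<close>)
  show "0 \<le> (suminf (\<lambda>j. 2 * e j / 3 ^ Suc j))"
    using e' by (intro suminf_nonneg sm) auto
  have "(suminf (\<lambda>j. 2 * e j / 3 ^ Suc j)) \<le> (suminf (\<lambda>j. 2 / 3 * (1 / 3) ^ j))"
    by (intro suminf_le le sm sums_summable[OF geo])
  then show "(suminf (\<lambda>j. 2 * e j / 3 ^ Suc j)) \<le> 1"
    using sums_unique[OF geo] by simp
qed

text \<open>Let \<open>t\<close> lie in the Cantor set, with ternary digits \<open>2 e j\<close>. Multiplying \<open>t\<close> by \<open>3\<^sup>k\<close> moves the digits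
  before position \<open>k\<close> in front of the point, where they add up to an even integer, and the later
  digits contribute at most \<open>1/3\<close>. The wave thus reads off the digit at position \<open>k\<close>.\<close>

lemma schoenberg_wave_of_ternary:
  assumes e: "\<And>j. e j = 0 \<or> e j = (1::real)"
  shows "schoenberg_wave (3 ^ k * (suminf (\<lambda>j. 2 * e j / 3 ^ Suc j))) = e k"
proof -
  define g where "g = (\<lambda>j. 2 * e j / 3 ^ Suc j)"
  define m :: int where "m = (\<Sum>j<k. (if e j = 0 then 0 else 3 ^ (k - Suc j)))"
  define r where "r = (suminf (\<lambda>j. 2 * e (j + Suc k) / 3 ^ Suc j))"
  have sm: "summable g"
    using ternary_digits_bounds(1)[of e, OF e] by (simp add: g_def)
  have smr: "summable (\<lambda>j. 2 * e (j + Suc k) / 3 ^ Suc j)"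
    and r: "0 \<le> r" "r \<le> 1"
    using ternary_digits_bounds[of "\<lambda>j. e (j + Suc k)", OF e] by (simp_all add: r_def)
  have "3 ^ k * suminf g = 3 ^ k * ((suminf (\<lambda>j. g (j + Suc k))) + (\<Sum>j<Suc k. g j))"
    using suminf_split_initial_segment[OF sm, of "Suc k"] by simp
  also have "(suminf (\<lambda>j. g (j + Suc k))) = (suminf (\<lambda>j. 2 * e (j + Suc k) / 3 ^ Suc j * (1 / 3 ^ Suc k)))"
    by (intro suminf_cong) (simp add: g_def power_add field_simps)
  also have "\<dots> = r * (1 / 3 ^ Suc k)"
    unfolding r_def by (rule suminf_mult2[OF smr, symmetric])
  also have "3 ^ k * (r * (1 / 3 ^ Suc k) + (\<Sum>j<Suc k. g j))
      = 3 ^ k * (\<Sum>j<k. g j) + 2 * e k / 3 + r / 3"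
    by (simp add: g_def field_simps)
  also have "3 ^ k * (\<Sum>j<k. g j) = 2 * of_int m"
  proof -
    have "3 ^ k * g j = 2 * of_int (if e j = 0 then 0 else 3 ^ (k - Suc j))" if "j < k" for j
    proof -
      have "(3::real) ^ k = 3 ^ (k - Suc j) * 3 ^ Suc j"
        using that by (simp only: power_add[symmetric]) simp
      then show ?thesis
        using e[of j] by (auto simp: g_def)
    qed
    then show ?thesis
      unfolding m_def sum_distrib_left of_int_sum by (intro sum.cong) auto
  qed
  finally have "3 ^ k * suminf g
      = 2 * of_int m + 2 * e k / 3 + r / 3" .
  then show ?thesis
    using schoenberg_wave_reads_digit[OF e[of k], of "r / 3" m] r by (simp add: g_def)
qed

text \<open>The two coordinates of Schoenberg's curve in the square: coordinate \<open>0\<close> has as binary digits the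
  readings of the wave at the even ternary positions, coordinate \<open>1\<close> those at the odd ones.\<close>

definition schoenberg_coordinate :: "nat \<Rightarrow> real \<Rightarrow> real" where
  "schoenberg_coordinate i t = (suminf (\<lambda>k. schoenberg_wave (3 ^ (2 * k + i) * t) / 2 ^ Suc k))"

lemma continuous_schoenberg_coordinate: "continuous_on UNIV (schoenberg_coordinate i)"
proof -
  have "uniform_limit UNIV (\<lambda>n t. \<Sum>k<n. schoenberg_wave (3 ^ (2 * k + i) * t) / 2 ^ Suc k)
      (\<lambda>t. suminf (\<lambda>k. schoenberg_wave (3 ^ (2 * k + i) * t) / 2 ^ Suc k)) sequentially"
  proof (rule Weierstrass_m_test)
    show "norm (schoenberg_wave (3 ^ (2 * k + i) * t) / 2 ^ Suc k) \<le> (1 / 2) ^ Suc k" for k t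
      using schoenberg_wave_bounds[of "3 ^ (2 * k + i) * t"] by (simp add: field_simps)
    show "summable (\<lambda>k. (1 / 2) ^ Suc k :: real)"
      by (subst summable_Suc_iff) (rule summable_geometric, simp)
  qed
  then show ?thesis
    unfolding schoenberg_coordinate_def
    by (rule uniform_limit_theorem[rotated])
       (auto intro!: always_eventually continuous_intros
          continuous_on_compose2[OF continuous_schoenberg_wave[of UNIV]])
qed

text \<open>Interleave the binary digits of \<open>a\<close> and \<open>b\<close> to form the ternary digits of a point of the Cantor set.\<close>

lemma schoenberg_curve_fills_square:
  assumes a: "0 \<le> a" "a < 1" and b: "0 \<le> b" "b < 1"
  shows "\<exists>t\<in>{0..1}. schoenberg_coordinate 0 t = a \<and> schoenberg_coordinate 1 t = b"
proof -
  define e where "e j = (if even j then binary_digit a (j div 2) else binary_digit b (j div 2))" for j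
  define t where "t = (suminf (\<lambda>j. 2 * e j / 3 ^ Suc j))"
  have e: "e j = 0 \<or> e j = 1" for j
    using binary_digit_cases by (auto simp: e_def)
  have wave: "schoenberg_wave (3 ^ k * t) = e k" for k
    unfolding t_def by (rule schoenberg_wave_of_ternary[OF e])
  have "e (2 * k) = binary_digit a k" "e (2 * k + 1) = binary_digit b k" for k
    by (auto simp: e_def)
  then have "schoenberg_coordinate 0 t = a" "schoenberg_coordinate 1 t = b"
    using sums_unique[OF binary_digit_sums[OF a]] sums_unique[OF binary_digit_sums[OF b]]
    by (simp_all only: schoenberg_coordinate_def wave add_0_right)
  moreover have "t \<in> {0..1}"
    using ternary_digits_bounds[of e, OF e] by (simp add: t_def)
  ultimately show ?thesis
    by blast
qed

text \<open>Spherical coordinates with both angles in \<open>[0, 2 \<pi>)\<close> cover the sphere. The doubled range of the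
  polar angle is harmless, and it makes the half-open square sufficient.\<close>

lemma space_filling_curve_sphere:
  obtains c :: "real \<Rightarrow> real^3"
  where "continuous_on UNIV c" "c ` {0..1} = sphere 0 1" "range c \<subseteq> sphere 0 1"
proof
  define c :: "real \<Rightarrow> real^3" where "c = (\<lambda>t.
    let u = 2 * pi * schoenberg_coordinate 0 t; v = 2 * pi * schoenberg_coordinate 1 t
    in vector [cos u * sin v, sin u * sin v, cos v])"
  have "continuous_on UNIV (\<lambda>t. c t $ i)" for i
    using exhaust_3[of i]
    by (elim disjE; simp only: c_def Let_def vector_3;
        intro continuous_intros continuous_schoenberg_coordinate)
  then show "continuous_on UNIV c"
    using continuous_on_vec_lambda[of UNIV "\<lambda>i t. c t $ i"] by simp
  have norm3: "norm x = sqrt ((x$1)\<^sup>2 + (x$2)\<^sup>2 + (x$3)\<^sup>2)" for x :: "real^3"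
    by (simp add: norm_vec_def L2_set_def sum_3)
  have one: "(cos u * sin v)\<^sup>2 + (sin u * sin v)\<^sup>2 + (cos v)\<^sup>2 = 1" for u v :: real
  proof -
    have "(cos u * sin v)\<^sup>2 + (sin u * sin v)\<^sup>2 = ((cos u)\<^sup>2 + (sin u)\<^sup>2) * (sin v)\<^sup>2"
      by (simp only: power_mult_distrib distrib_right)
    then show ?thesis
      by simp
  qed
  have sub: "c t \<in> sphere 0 1" for t
    by (simp add: norm3 c_def Let_def vector_3 one)
  then show "range c \<subseteq> sphere 0 1"
    by blast
  have "x \<in> c ` {0..1}" if "x \<in> sphere 0 1" for x
  proof -
    from that have x1: "(x$1)\<^sup>2 + (x$2)\<^sup>2 + (x$3)\<^sup>2 = 1"
      by (simp add: norm3)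
    define \<rho> where "\<rho> = sqrt ((x$1)\<^sup>2 + (x$2)\<^sup>2)"
    have \<rho>2: "\<rho>\<^sup>2 = (x$1)\<^sup>2 + (x$2)\<^sup>2"
      by (simp add: \<rho>_def)
    then have "(x$3)\<^sup>2 + \<rho>\<^sup>2 = 1"
      using x1 by simp
    then obtain v where v: "0 \<le> v" "v < 2 * pi" "x$3 = cos v" "\<rho> = sin v"
      by (rule sincos_total_2pi)
    obtain u where u: "0 \<le> u" "u < 2 * pi" "x$1 = cos u * \<rho>" "x$2 = sin u * \<rho>"
    proof (cases "\<rho> = 0")
      case True
      then have "x$1 = 0" "x$2 = 0"
        using \<rho>2 by (simp_all add: sum_power2_eq_zero_iff)
      with True show ?thesis
        by (intro that[of 0]) auto
    next
      case False
      then have "(x$1 / \<rho>)\<^sup>2 + (x$2 / \<rho>)\<^sup>2 = 1"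
        by (simp add: power_divide \<rho>2[symmetric] add_divide_distrib[symmetric])
      then obtain u where "0 \<le> u" "u < 2 * pi" "x$1 / \<rho> = cos u" "x$2 / \<rho> = sin u"
        by (rule sincos_total_2pi)
      with False show ?thesis
        by (intro that[of u]) (auto simp: field_simps)
    qed
    obtain t where t: "t \<in> {0..1}" "schoenberg_coordinate 0 t = u / (2 * pi)"
        "schoenberg_coordinate 1 t = v / (2 * pi)"
      using schoenberg_curve_fills_square[of "u / (2 * pi)" "v / (2 * pi)"] u v by auto
    have "c t = x"
      using t(2,3) u v by (simp add: vec_eq_iff forall_3 c_def Let_def vector_3)
    with t(1) show ?thesis
      by blast
  qed
  with sub show "c ` {0..1} = sphere 0 1"
    by blast
qed

section \<open>Branched coverings of the sphere\<close>

lemma oriented_sphere_homeomorphism: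
  fixes \<A> :: "'a::topological_space chart set"
  assumes "oriented_sphere \<A>"
  obtains h g where "homeomorphism (UNIV :: 'a set) (sphere (0 :: real^3) 1) h g"
  using assms unfolding oriented_sphere_def homeomorphic_def by blast

lemma sphere_homeomorphism_imp:
  fixes h :: "'a::topological_space \<Rightarrow> real^3"
  assumes hg: "homeomorphism (UNIV :: 'a set) (sphere (0 :: real^3) 1) h g"
  shows "compact (UNIV :: 'a set)" "connected (UNIV :: 'a set)"
    "Hausdorff_space (euclidean :: 'a topology)"
proof -
  have hom: "(UNIV :: 'a set) homeomorphic sphere (0 :: real^3) 1"
    using hg by (auto simp: homeomorphic_def)
  show "compact (UNIV :: 'a set)"
    using homeomorphic_compactness[OF hom] by simp
  show "connected (UNIV :: 'a set)"
    using homeomorphic_connectedness[OF hom] by (simp add: connected_sphere)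
  have "inj h"
    by (metis hg UNIV_I homeomorphism_apply1 injI)
  moreover have "continuous_on UNIV h"
    using hg by (rule homeomorphism_cont1)
  ultimately show "Hausdorff_space (euclidean :: 'a topology)"
    by (intro Hausdorff_space_injective_preimage[of "euclidean :: (real^3) topology" _ h]) auto
qed

lemma compact_imp_closed_Hausdorff:
  fixes K :: "'a::topological_space set"
  assumes "Hausdorff_space (euclidean :: 'a topology)" "compact K"
  shows "closed K"
  using compactin_imp_closedin[OF assms(1), of K] assms(2)
  by (simp only: closed_closedin compactin_euclidean_iff)

lemma chart_image_open:
  assumes "is_chart (U, p)" "open W" "W \<subseteq> U"
  shows "open (p ` W)"
proof -
  obtain q where U: "open U" "open (p ` U)" "homeomorphism U (p ` U) p q"
    using assms(1) by (auto simp: is_chart_def)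
  have "openin (top_of_set U) W"
    using assms(2,3) by (simp add: open_subset)
  then have "openin (top_of_set (p ` U)) (p ` W)"
    using homeomorphism_imp_open_map[OF U(3)] by blast
  then show ?thesis
    using U(2) openin_open_trans by blast
qed

lemma chart_inj: "is_chart (U, p) \<Longrightarrow> inj_on p U"
  unfolding is_chart_def by (auto simp: homeomorphism_def inj_on_def) metis

lemma chart_continuous: "is_chart (U, p) \<Longrightarrow> continuous_on U p"
  unfolding is_chart_def by (auto simp: homeomorphism_def)

text \<open>Charts make the space locally connected: the preimage of a small disc in a chart is a connected
  neighbourhood.\<close>

lemma open_component_of_charted:
  fixes A :: "'a::topological_space set"
  assumes charts: "\<And>x::'a. \<exists>U p. x \<in> U \<and> is_chart (U, p)"
    and "open A" and W: "W \<in> components A"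
  shows "open W"
proof (subst open_subopen, intro ballI)
  fix x assume x: "x \<in> W"
  with W have xA: "x \<in> A"
    using in_components_subset by blast
  obtain U p where U: "x \<in> U" "is_chart (U, p)"
    using charts by blast
  then obtain q where q: "open U" "homeomorphism U (p ` U) p q"
    by (auto simp: is_chart_def)
  have "open (p ` (U \<inter> A))"
    using U(2) q(1) \<open>open A\<close> by (intro chart_image_open) auto
  moreover have "p x \<in> p ` (U \<inter> A)"
    using U(1) xA by blast
  ultimately obtain r where r: "r > 0" "ball (p x) r \<subseteq> p ` (U \<inter> A)"
    by (meson openE)
  have inv: "q (p y) = y" if "y \<in> U" for y
    using q(2) that by (rule homeomorphism_apply1)
  define N where "N = q ` ball (p x) r"
  have "ball (p x) r \<subseteq> p ` U"
    using r(2) by blast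
  then have cont: "continuous_on (ball (p x) r) q"
    using homeomorphism_cont2[OF q(2)] continuous_on_subset by blast
  have "N \<subseteq> A" "N \<subseteq> U"
    using r(2) inv by (force simp: N_def)+
  have "N = p -` ball (p x) r \<inter> U"
    using r(2) inv by (force simp: N_def)
  then have "open N"
    using chart_continuous[OF U(2)] continuous_on_open_vimage[OF q(1), of p] by simp
  have "x \<in> N"
    unfolding N_def using inv[OF U(1)] r(1) by (force intro: rev_image_eqI[of "p x"])
  have "connected N"
    unfolding N_def by (intro connected_continuous_image cont connected_ball)
  then have "N \<subseteq> W"
    using components_maximal[OF W] \<open>N \<subseteq> A\<close> \<open>x \<in> N\<close> x by blast
  then show "\<exists>T. open T \<and> x \<in> T \<and> T \<subseteq> W"
    using \<open>open N\<close> \<open>x \<in> N\<close> by blast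
qed

lemma open_image_power:
  assumes "open S" "k \<ge> (1::nat)"
  shows "open ((\<lambda>z::complex. z ^ k) ` S)"
proof (rule open_mapping_thm[of _ UNIV])
  show "\<not> (\<lambda>z::complex. z ^ k) constant_on UNIV"
  proof
    assume "(\<lambda>z::complex. z ^ k) constant_on UNIV"
    then have "(0::complex) ^ k = 1 ^ k"
      unfolding constant_on_def by (metis UNIV_I)
    with \<open>k \<ge> 1\<close> show False
      by (simp add: power_0_left split: if_splits)
  qed
qed (use assms in \<open>auto intro!: holomorphic_intros\<close>)

lemma has_local_degreeE:
  assumes "has_local_degree \<A> f x k"
  obtains U p V q where "k \<ge> 1" "is_chart (U, p)" "x \<in> U" "p x = 0" "is_chart (V, q)"
    "q (f x) = 0" "f ` U \<subseteq> V" "\<And>y. y \<in> U \<Longrightarrow> q (f y) = p y ^ k"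
proof -
  have *: "k \<ge> 1 \<and> (\<exists>U p V q. is_chart (U, p) \<and> x \<in> U \<and> p x = 0 \<and> is_chart (V, q) \<and>
      q (f x) = 0 \<and> f ` U \<subseteq> V \<and> (\<forall>y\<in>U. q (f y) = p y ^ k))"
    using assms unfolding has_local_degree_def oriented_chart_def
    by (elim conjE exE, intro conjI exI) assumption+
  then show thesis
    by (elim conjE exE) (rule that, (assumption | erule bspec)+)
qed

text \<open>In local coordinates \<open>f\<close> is the map \<open>z \<mapsto> z\<^sup>k\<close>, which is open by the open mapping theorem.\<close>

lemma branched_covering_open_map:
  assumes bc: "branched_covering \<A> f" and "open W"
  shows "open (f ` W)"
proof (subst open_subopen, intro ballI)
  fix y assume "y \<in> f ` W"
  then obtain x where x: "x \<in> W" "y = f x"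
    by blast
  obtain k where "has_local_degree \<A> f x k"
    using bc by (auto simp: branched_covering_def)
  then obtain U p V q where k: "k \<ge> 1" and
    U: "is_chart (U, p)" "x \<in> U" and V: "is_chart (V, q)" "f ` U \<subseteq> V" and
    eq: "\<And>y. y \<in> U \<Longrightarrow> q (f y) = p y ^ k"
    by (rule has_local_degreeE) blast
  have op: "open U" "open V"
    using U V by (auto simp: is_chart_def)
  define P where "P = (\<lambda>z. z ^ k) ` p ` (U \<inter> W)"
  have "open P"
    unfolding P_def using op \<open>open W\<close> U k by (intro open_image_power chart_image_open) auto
  have "f ` (U \<inter> W) = q -` P \<inter> V"
  proof
    show "f ` (U \<inter> W) \<subseteq> q -` P \<inter> V"
      using V(2) by (auto simp: P_def eq)
    show "q -` P \<inter> V \<subseteq> f ` (U \<inter> W)"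
    proof
      fix v assume "v \<in> q -` P \<inter> V"
      then obtain w where w: "w \<in> U \<inter> W" "q v = p w ^ k" "v \<in> V"
        by (auto simp: P_def)
      then have "q v = q (f w)" "f w \<in> V"
        using eq V(2) by auto
      then have "v = f w"
        using chart_inj[OF V(1)] w(3) by (meson inj_onD)
      with w(1) show "v \<in> f ` (U \<inter> W)"
        by blast
    qed
  qed
  moreover have "open (q -` P \<inter> V)"
    using chart_continuous[OF V(1)] continuous_on_open_vimage[OF op(2), of q] \<open>open P\<close> by blast
  ultimately have "open (f ` (U \<inter> W))"
    by simp
  then show "\<exists>T. open T \<and> y \<in> T \<and> T \<subseteq> f ` W"
    using x U(2) by blast
qed

text \<open>The equation \<open>z\<^sup>k = 0\<close> has only the solution \<open>0\<close>, so the fibres are discrete, and they are compact.\<close>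

lemma branched_covering_finite_fibre:
  fixes f :: "'a::topological_space \<Rightarrow> 'a"
  assumes bc: "branched_covering \<A> f"
    and cpt: "compact (UNIV :: 'a set)" and T2: "Hausdorff_space (euclidean :: 'a topology)"
  shows "finite (f -` {z})"
proof -
  have "closed {z}"
    using compact_imp_closed_Hausdorff[OF T2] by simp
  moreover have "continuous_on UNIV f"
    using bc by (simp add: branched_covering_def)
  ultimately have "closed (f -` {z})"
    using continuous_on_closed_vimage by (metis Int_UNIV_right closed_UNIV)
  then have cF: "compact (f -` {z})"
    using compact_Int_closed[OF cpt] by simp
  have "\<exists>U. open U \<and> x \<in> U \<and> U \<inter> f -` {z} = {x}" if x: "f x = z" for x
  proof -
    obtain k where "has_local_degree \<A> f x k"
      using bc by (auto simp: branched_covering_def)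
    then obtain U p V q where k: "k \<ge> 1" and
      U: "is_chart (U, p)" "x \<in> U" "p x = 0" and V: "q (f x) = 0" and
      eq: "\<And>y. y \<in> U \<Longrightarrow> q (f y) = p y ^ k"
      by (rule has_local_degreeE) blast
    have "y = x" if "y \<in> U" "f y = z" for y
    proof -
      have "p y ^ k = 0"
        using eq[OF that(1)] that(2) x V by simp
      then have "p y = p x"
        using U(3) by simp
      then show ?thesis
        using chart_inj[OF U(1)] U(2) that(1) by (meson inj_onD)
    qed
    then have "U \<inter> f -` {z} = {x}"
      using U(2) x by blast
    moreover have "open U"
      using U(1) by (simp add: is_chart_def)
    ultimately show ?thesis
      using U(2) by blast
  qed
  then obtain N where N: "\<And>x. x \<in> f -` {z} \<Longrightarrow> open (N x) \<and> x \<in> N x \<and> N x \<inter> f -` {z} = {x}"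
    by (metis vimage_singleton_eq)
  obtain D where D: "D \<subseteq> f -` {z}" "finite D" "f -` {z} \<subseteq> (\<Union>x\<in>D. N x)"
    using compactE_image[OF cF, of "f -` {z}" N] N by blast
  have "f -` {z} \<subseteq> D"
  proof
    fix x assume x: "x \<in> f -` {z}"
    then obtain y where y: "y \<in> D" "x \<in> N y"
      using D(3) by blast
    then have "N y \<inter> f -` {z} = {y}"
      using N D(1) by blast
    then have "x \<in> {y}"
      using x y(2) by blast
    then show "x \<in> D"
      using y(1) by simp
  qed
  then show ?thesis
    using D(2) finite_subset by blast
qed

text \<open>The image is open by assumption and closed by compactness.\<close>

lemma open_map_surj:
  fixes f :: "'a::topological_space \<Rightarrow> 'a"
  assumes "compact (UNIV :: 'a set)" "connected (UNIV :: 'a set)"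
    and T2: "Hausdorff_space (euclidean :: 'a topology)"
    and "continuous_on UNIV f" and "open (range f)"
  shows "surj f"
proof -
  have "closed (range f)"
    using assms by (intro compact_imp_closed_Hausdorff compact_continuous_image)
  then have "range f \<inter> UNIV = {} \<or> - range f \<inter> UNIV = {}"
    using assms(2,5) by (intro connectedD) (auto simp: open_Compl)
  then show ?thesis
    by blast
qed

text \<open>Removing a point would give a homeomorphism between a line and a plane.\<close>

lemma circle_not_homeomorphic_sphere: "\<not> sphere (0::complex) 1 homeomorphic sphere (0::real^3) 1"
proof
  assume "sphere (0::complex) 1 homeomorphic sphere (0::real^3) 1"
  then obtain k l where kl: "homeomorphism (sphere (0::complex) 1) (sphere (0::real^3) 1) k l"
    by (auto simp: homeomorphic_def)
  have k1: "k 1 \<in> sphere 0 1"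
    using homeomorphism_image1[OF kl] by force
  have im: "k ` (sphere 0 1 - {1}) = sphere 0 1 - {k 1}"
    using kl by (auto simp: homeomorphism_def) (metis dist_0_norm norm_one mem_sphere)+
  have "(UNIV :: real set) homeomorphic (sphere (0::complex) 1 - {1})"
    by (subst homeomorphic_sym, rule homeomorphic_punctured_sphere_affine) auto
  also have "sphere (0::complex) 1 - {1} homeomorphic (sphere (0::real^3) 1 - {k 1})"
    unfolding homeomorphic_def using homeomorphism_of_subsets[OF kl _ _ im, of "sphere 0 1 - {k 1}"] by blast
  also have "(sphere (0::real^3) 1 - {k 1}) homeomorphic (UNIV :: complex set)"
    using k1 by (intro homeomorphic_punctured_sphere_affine) auto
  finally have "(UNIV :: complex set) homeomorphic (UNIV :: real set)"
    using homeomorphic_sym by blast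
  then obtain u v where uv: "homeomorphism (UNIV :: complex set) (UNIV :: real set) u v"
    by (auto simp: homeomorphic_def)
  have "continuous_on UNIV u" "range u \<subseteq> UNIV" "inj u"
    using uv by (simp_all add: homeomorphism_def) (metis injI)
  then have "DIM(complex) \<le> DIM(real)"
    using invariance_of_dimension[of UNIV u] by simp
  then show False
    by simp
qed

lemma homeomorphic_circle_simple_path:
  fixes D :: "complex set"
  assumes "D homeomorphic sphere (0::complex) 1"
  obtains c where "simple_path c" "pathfinish c = pathstart c" "path_image c = D"
proof -
  obtain k l where kl: "homeomorphism (sphere (0::complex) 1) D k l"
    using homeomorphic_sym[THEN iffD1, OF assms] unfolding homeomorphic_def by blast
  have im: "path_image (circlepath 0 1) = sphere (0::complex) 1"
    by simp
  have "inj_on k (sphere 0 1)"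
    using homeomorphism_apply1[OF kl] by (metis inj_onI)
  then have "simple_path (k \<circ> circlepath 0 1)"
    using homeomorphism_cont1[OF kl]
    by (intro simple_path_continuous_image) (simp_all add: simple_path_circlepath)
  moreover have "pathfinish (k \<circ> circlepath 0 1) = pathstart (k \<circ> circlepath 0 1)"
    by (simp add: pathfinish_compose pathstart_compose)
  moreover have "path_image (k \<circ> circlepath 0 1) = D"
    using homeomorphism_image1[OF kl] by (simp add: path_image_compose im)
  ultimately show ?thesis
    using that by blast
qed

text \<open>Stereographic projection from a point \<open>b\<close> off the curve carries the curve to a Jordan curve in the
  plane. The complement in the sphere is then covered by three connected sets: the images of the
  inside and of the outside, and \<open>{b}\<close>. The curve has empty interior since in the plane it is the
  frontier of its inside, which it does not meet.\<close>

lemma Jordan_curve_in_sphere: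
  fixes C :: "'a::topological_space set" and h :: "'a \<Rightarrow> real^3"
  assumes hg: "homeomorphism (UNIV :: 'a set) (sphere (0 :: real^3) 1) h g"
    and C: "Jordan_curve C"
  shows "closed C" "finite (components (- C))" "\<And>U. open U \<Longrightarrow> U \<subseteq> C \<Longrightarrow> U = {}"
proof -
  have "compact C"
    using C homeomorphic_compactness[of C "sphere (0::complex) 1"] by (simp add: Jordan_curve_def)
  then show "closed C"
    by (rule compact_imp_closed_Hausdorff[OF sphere_homeomorphism_imp(3)[OF hg]])
  have "C \<noteq> UNIV"
  proof
    assume "C = UNIV"
    then have "sphere (0::complex) 1 homeomorphic (UNIV :: 'a set)"
      using C homeomorphic_sym unfolding Jordan_curve_def by blast
    moreover have "(UNIV :: 'a set) homeomorphic sphere (0 :: real^3) 1"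
      using hg unfolding homeomorphic_def by blast
    ultimately have "sphere (0::complex) 1 homeomorphic sphere (0 :: real^3) 1"
      by (rule homeomorphic_trans)
    then show False
      using circle_not_homeomorphic_sphere by contradiction
  qed
  then obtain b where b: "b \<notin> C"
    by blast
  have hb: "h b \<in> sphere 0 1"
    using homeomorphism_image1[OF hg] by blast
  have "inj h"
    by (metis hg UNIV_I homeomorphism_apply1 injI)
  then have "h ` (UNIV - {b}) = sphere 0 1 - {h b}"
    using homeomorphism_image1[OF hg] by (simp add: image_set_diff)
  then have "homeomorphism (UNIV - {b}) (sphere 0 1 - {h b}) h g"
    by (intro homeomorphism_of_subsets[OF hg]) auto
  then have "(UNIV - {b}) homeomorphic (sphere 0 1 - {h b})"
    unfolding homeomorphic_def by blast
  also have "(sphere 0 1 - {h b}) homeomorphic (UNIV :: complex set)"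
    using hb by (intro homeomorphic_punctured_sphere_affine) auto
  finally obtain k l where kl: "homeomorphism (UNIV - {b}) (UNIV :: complex set) k l"
    unfolding homeomorphic_def by blast
  have lk: "l (k x) = x" if "x \<noteq> b" for x
    using kl that by (auto simp: homeomorphism_def)
  have kl': "k (l z) = z" "l z \<noteq> b" for z
    using kl by (auto simp: homeomorphism_def)
  have lcont: "continuous_on A l" for A
    using homeomorphism_cont2[OF kl] continuous_on_subset by blast
  define D where "D = k ` C"
  have "homeomorphism C D k l"
    unfolding D_def using b by (intro homeomorphism_of_subsets[OF kl]) auto
  then have "C homeomorphic D"
    unfolding homeomorphic_def by blast
  then have "D homeomorphic sphere (0::complex) 1"
    using C homeomorphic_trans[of D C] homeomorphic_sym[of C D] by (simp add: Jordan_curve_def)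
  then obtain c where c: "simple_path c" "pathfinish c = pathstart c" "path_image c = D"
    by (rule homeomorphic_circle_simple_path)
  note J = Jordan_inside_outside[OF c(1,2), unfolded c(3)]
  have cover: "- C \<subseteq> l ` inside D \<union> l ` outside D \<union> {b}"
  proof
    fix x assume x: "x \<in> - C"
    show "x \<in> l ` inside D \<union> l ` outside D \<union> {b}"
    proof (cases "x = b")
      case False
      have "k x \<notin> D"
        using x False lk b unfolding D_def by (metis ComplD image_iff)
      then have "k x \<in> inside D \<union> outside D"
        using J by blast
      then show ?thesis
        using lk[OF False] by (metis UnCI UnE image_eqI)
    qed auto
  qed
  have sub: "l ` inside D \<subseteq> - C" "l ` outside D \<subseteq> - C"
  proof -
    have "l z \<notin> C" if "z \<in> inside D \<or> z \<in> outside D" for z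
    proof
      assume "l z \<in> C"
      then have "z \<in> D"
        unfolding D_def using kl'(1)[of z] by (metis imageI)
      with that J show False
        by blast
    qed
    then show "l ` inside D \<subseteq> - C" "l ` outside D \<subseteq> - C"
      by auto
  qed
  have const: "\<exists>K. \<forall>x\<in>l ` E. connected_component_set (- C) x = K"
    if E: "connected E" "l ` E \<subseteq> - C" for E
  proof (cases "E = {}")
    case False
    then obtain z where z: "z \<in> E"
      by blast
    have "connected_component (- C) (l z) x" if "x \<in> l ` E" for x
      unfolding connected_component_def
      using connected_continuous_image[OF lcont E(1)] E(2) z that by blast
    then show ?thesis
      by (metis connected_component_eq_eq connected_component_in(1))
  qed auto
  obtain K1 K2 where K: "\<And>x. x \<in> l ` inside D \<Longrightarrow> connected_component_set (- C) x = K1"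
      "\<And>x. x \<in> l ` outside D \<Longrightarrow> connected_component_set (- C) x = K2"
    using const[OF _ sub(1)] const[OF _ sub(2)] J by metis
  have "components (- C) \<subseteq> {K1, K2, connected_component_set (- C) b}"
  proof
    fix W assume "W \<in> components (- C)"
    then obtain x where x: "x \<in> - C" "W = connected_component_set (- C) x"
      by (auto simp: components_def)
    from x(1) cover consider "x \<in> l ` inside D" | "x \<in> l ` outside D" | "x = b"
      by blast
    then show "W \<in> {K1, K2, connected_component_set (- C) b}"
      by cases (simp_all only: x(2) K insert_iff simp_thms)
  qed
  then show "finite (components (- C))"
    by (rule finite_subset) simp
  show "U = {}" if U: "open U" "U \<subseteq> C" for U
  proof (rule ccontr)
    assume "U \<noteq> {}"
    have "openin (top_of_set (UNIV - {b})) U"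
      using U b by (intro open_subset) auto
    then have "openin (top_of_set UNIV) (k ` U)"
      using homeomorphism_imp_open_map[OF kl] by blast
    then have "open (k ` U)"
      by simp
    have "k ` U \<subseteq> frontier (inside D)"
      using U(2) J by (auto simp: D_def)
    then have "k ` U \<inter> closure (inside D) \<noteq> {}"
      using \<open>U \<noteq> {}\<close> by (auto simp: frontier_def)
    then have "k ` U \<inter> inside D \<noteq> {}"
      using open_Int_closure_eq_empty[OF \<open>open (k ` U)\<close>] by blast
    moreover have "k ` U \<subseteq> D"
      using U(2) by (auto simp: D_def)
    ultimately show False
      using J inside_no_overlap[of D] by blast
  qed
qed

text \<open>Each component \<open>W\<close> of the preimage of \<open>- C\<close> is mapped onto a whole component \<open>\<Omega>\<close> of \<open>- C\<close>: the image
  is open because \<open>g\<close> is an open map, and closed in \<open>\<Omega>\<close> because the space is compact and \<open>W\<close> is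
  closed in the preimage. So \<open>W\<close> meets the fibre over a point chosen in \<open>\<Omega>\<close>, and these fibres
  contain only finitely many points in total.\<close>

lemma finite_components_vimage:
  fixes g :: "'a::topological_space \<Rightarrow> 'a"
  assumes cpt: "compact (UNIV :: 'a set)" and T2: "Hausdorff_space (euclidean :: 'a topology)"
    and charts: "\<And>x::'a. \<exists>U p. x \<in> U \<and> is_chart (U, p)"
    and cont: "continuous_on UNIV g" and op: "\<And>U. open U \<Longrightarrow> open (g ` U)"
    and fin: "\<And>y. finite (g -` {y})"
    and C: "closed C" "finite (components (- C))"
  shows "finite (components (- g -` C))"
proof -
  define A where "A = - g -` C"
  have "closed (g -` C)"
    using C(1) cont by (metis Int_UNIV_right closed_UNIV continuous_on_closed_vimage)
  then have "open A"
    by (simp add: A_def open_Compl)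
  have onto: "\<exists>\<Omega>\<in>components (- C). g ` W = \<Omega>" if W: "W \<in> components A" for W
  proof -
    have "W \<noteq> {}" "connected W" "W \<subseteq> A"
      using W in_components_nonempty in_components_connected in_components_subset by blast+
    have "connected (g ` W)"
      using \<open>connected W\<close> cont by (meson connected_continuous_image continuous_on_subset subset_UNIV)
    moreover have gW: "g ` W \<subseteq> - C" "g ` W \<noteq> {}"
      using \<open>W \<subseteq> A\<close> \<open>W \<noteq> {}\<close> by (auto simp: A_def)
    ultimately obtain \<Omega> where \<Omega>: "\<Omega> \<in> components (- C)" "g ` W \<subseteq> \<Omega>"
      using exists_component_superset[of "g ` W" "- C"] by blast
    have "open (g ` W)"
      using open_component_of_charted[OF charts \<open>open A\<close> W] op by blast
    have "compact (closure W)"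
      using compact_Int_closed[OF cpt closed_closure] by simp
    then have "closed (g ` closure W)"
      using cont by (intro compact_imp_closed_Hausdorff[OF T2] compact_continuous_image)
        (auto intro: continuous_on_subset)
    then have clsub: "closure (g ` W) \<subseteq> g ` closure W"
      by (intro closure_minimal image_mono closure_subset)
    have "closedin (top_of_set A) W"
      using closedin_component[OF W] .
    then obtain T where T: "closed T" "W = A \<inter> T"
      by (auto simp: closedin_closed)
    have "\<Omega> \<inter> closure (g ` W) \<subseteq> g ` W"
    proof
      fix y assume y: "y \<in> \<Omega> \<inter> closure (g ` W)"
      then obtain w where w: "w \<in> closure W" "y = g w"
        using clsub by blast
      have "y \<notin> C"
        using y \<Omega>(1) in_components_subset by fastforce
      then have "w \<in> A"
        using w by (simp add: A_def)
      moreover have "w \<in> T"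
        using w(1) T closure_minimal[of W T] by blast
      ultimately show "y \<in> g ` W"
        using T(2) w(2) by blast
    qed
    then have "\<Omega> \<subseteq> g ` W \<union> - closure (g ` W)"
      by blast
    then have "g ` W \<inter> \<Omega> = {} \<or> - closure (g ` W) \<inter> \<Omega> = {}"
      using in_components_connected[OF \<Omega>(1)] \<open>open (g ` W)\<close> closure_subset[of "g ` W"]
      by (intro connectedD) (auto simp: open_Compl)
    then have "\<Omega> \<subseteq> closure (g ` W)"
      using \<Omega>(2) gW(2) by blast
    then have "g ` W = \<Omega>"
      using \<open>\<Omega> \<inter> closure (g ` W) \<subseteq> g ` W\<close> \<Omega>(2) by blast
    with \<Omega>(1) show ?thesis
      by blast
  qed
  define z where "z \<Omega> = (SOME y. y \<in> \<Omega>)" for \<Omega> :: "'a set"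
  have z: "z \<Omega> \<in> \<Omega>" if "\<Omega> \<in> components (- C)" for \<Omega>
    unfolding z_def using in_components_nonempty[OF that] by (simp add: some_in_eq)
  define F where "F = (\<Union>\<Omega>\<in>components (- C). g -` {z \<Omega>})"
  have "finite F"
    unfolding F_def using C(2) fin by blast
  have "components A \<subseteq> connected_component_set A ` F"
  proof
    fix W assume W: "W \<in> components A"
    then obtain \<Omega> where \<Omega>: "\<Omega> \<in> components (- C)" "g ` W = \<Omega>"
      using onto by blast
    then obtain w where w: "w \<in> W" "g w = z \<Omega>"
      using z[OF \<Omega>(1)] by force
    have "w \<in> F"
      using w(2) \<Omega>(1) by (auto simp: F_def)
    moreover have "W = connected_component_set A w"
      using W w(1) by (metis components_iff connected_component_eq)
    ultimately show "W \<in> connected_component_set A ` F"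
      by blast
  qed
  then show ?thesis
    using \<open>finite F\<close> finite_surj unfolding A_def by blast
qed

section \<open>Tiles and the topology of a visual metric\<close>

lemma funpow_continuous:
  fixes f :: "'a::topological_space \<Rightarrow> 'a"
  assumes "continuous_on UNIV f"
  shows "continuous_on UNIV (f ^^ n)"
proof (induction n)
  case (Suc n)
  have "continuous_on UNIV (f \<circ> f ^^ n)"
    by (rule continuous_on_compose[OF Suc continuous_on_subset[OF assms]]) simp
  then show ?case
    by (simp only: funpow.simps)
qed (simp add: id_def)

lemma funpow_open_map:
  fixes f :: "'a::topological_space \<Rightarrow> 'a"
  assumes "\<And>U. open U \<Longrightarrow> open (f ` U)" "open U"
  shows "open ((f ^^ n) ` U)"
proof (induction n)
  case (Suc n)
  then show ?case
    using assms(1) by (simp only: funpow.simps image_comp[symmetric])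
qed (simp add: assms(2))

lemma funpow_finite_fibre:
  fixes f :: "'a \<Rightarrow> 'a"
  assumes "\<And>y. finite (f -` {y})"
  shows "finite ((f ^^ n) -` {y})"
proof (induction n arbitrary: y)
  case (Suc n)
  have "(f ^^ Suc n) -` {y} = (\<Union>z\<in>f -` {y}. (f ^^ n) -` {z})"
    by auto
  moreover have "finite (\<Union>z\<in>f -` {y}. (f ^^ n) -` {z})"
    using Suc assms by (intro finite_UN_I)
  ultimately show ?case
    by (simp only:)
qed (simp add: vimage_def)

text \<open>The tiles are the closures of the components counted in \<open>finite_components_vimage\<close>, so their union is
  closed. Its complement is open and is mapped by \<open>f\<^sup>n\<close> into the Jordan curve, whose interior is
  empty; as \<open>f\<^sup>n\<close> is open, the complement is empty.\<close>

lemma n_tiles_finite_cover: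
  fixes f :: "'a::topological_space \<Rightarrow> 'a"
  assumes sph: "oriented_sphere \<A>" and bc: "branched_covering \<A> f" and C: "Jordan_curve C"
  shows "finite (n_tiles f C n)" "\<Union> (n_tiles f C n) = UNIV"
proof -
  obtain h g where hg: "homeomorphism (UNIV :: 'a set) (sphere (0 :: real^3) 1) h g"
    using sph by (rule oriented_sphere_homeomorphism)
  note top = sphere_homeomorphism_imp[OF hg]
  have charts: "\<exists>U p. x \<in> U \<and> is_chart (U, p)" for x :: 'a
  proof -
    have "x \<in> (\<Union>c\<in>\<A>. fst c)"
      using sph by (simp add: oriented_sphere_def)
    then obtain U p where "(U, p) \<in> \<A>" "x \<in> U"
      by auto
    with sph show ?thesis
      by (auto simp: oriented_sphere_def)
  qed
  have op: "open ((f ^^ n) ` U)" if "open U" for U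
    using funpow_open_map[OF branched_covering_open_map[OF bc] that] .
  have "continuous_on UNIV f"
    using bc by (simp add: branched_covering_def)
  then have "finite (components (- (f ^^ n) -` C))"
    by (intro finite_components_vimage top charts op funpow_continuous funpow_finite_fibre
        branched_covering_finite_fibre[OF bc] Jordan_curve_in_sphere[OF hg C])
  then have fin: "finite (components (UNIV - (f ^^ n) -` C))"
    by (simp add: Compl_eq_Diff_UNIV)
  then show fin': "finite (n_tiles f C n)"
    by (simp add: n_tiles_def)
  have "closed (\<Union> (n_tiles f C n))"
    using fin' by (auto simp: n_tiles_def intro!: closed_Union)
  then have "open (- \<Union> (n_tiles f C n))"
    by (rule open_Compl)
  moreover have "UNIV - (f ^^ n) -` C \<subseteq> \<Union> (n_tiles f C n)"
  proof
    fix x assume "x \<in> UNIV - (f ^^ n) -` C"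
    then obtain W where W: "W \<in> components (UNIV - (f ^^ n) -` C)" "x \<in> W"
      using Union_components[of "UNIV - (f ^^ n) -` C"] by blast
    then have "closure W \<in> n_tiles f C n" "x \<in> closure W"
      using closure_subset by (auto simp: n_tiles_def)
    then show "x \<in> \<Union> (n_tiles f C n)"
      by blast
  qed
  then have "(f ^^ n) ` (- \<Union> (n_tiles f C n)) \<subseteq> C"
    by blast
  ultimately have "(f ^^ n) ` (- \<Union> (n_tiles f C n)) = {}"
    using Jordan_curve_in_sphere(3)[OF hg C] op by blast
  then show "\<Union> (n_tiles f C n) = UNIV"
    by blast
qed

lemma visual_metric_tiles:
  assumes "visual_metric \<A> f d"
  obtains \<Lambda> C K where "Metric_space UNIV d" "\<Lambda> > 1" "Jordan_curve C" "K \<ge> 1"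
    "\<And>n T x y. T \<in> n_tiles f C n \<Longrightarrow> x \<in> T \<Longrightarrow> y \<in> T \<Longrightarrow> d x y \<le> K / \<Lambda> ^ n"
proof -
  obtain \<Lambda> C K where ms: "Metric_space UNIV d" and C: "\<Lambda> > 1" "Jordan_curve C" "K \<ge> 1" and
    T: "\<And>n T. T \<in> n_tiles f C n \<Longrightarrow> Metric_space.mbounded UNIV d T \<and> diam d T \<le> K / \<Lambda> ^ n"
  proof -
    obtain \<Lambda> where "visual_metric_factor \<A> f d \<Lambda>"
      using assms unfolding visual_metric_def by (rule exE)
    then show thesis
      unfolding visual_metric_factor_def
    proof (elim conjE exE)
      fix C K
      assume *: "Metric_space UNIV d" "\<Lambda> > 1" "Jordan_curve C" "K \<ge> 1" and
        "\<forall>n. (\<forall>\<sigma>\<in>n_cells \<A> f C n. \<forall>\<tau>\<in>n_cells \<A> f C n.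
             \<sigma> \<inter> \<tau> = {} \<longrightarrow> set_distance d \<sigma> \<tau> \<ge> 1 / (K * \<Lambda> ^ n)) \<and>
          (\<forall>\<tau>\<in>n_edges \<A> f C n \<union> n_tiles f C n.
             Metric_space.mbounded UNIV d \<tau> \<and>
             1 / (K * \<Lambda> ^ n) \<le> diam d \<tau> \<and> diam d \<tau> \<le> K / \<Lambda> ^ n)"
      then have "Metric_space.mbounded UNIV d T \<and> diam d T \<le> K / \<Lambda> ^ n"
        if "T \<in> n_tiles f C n" for n T
        using that by (meson UnI2)
      with * show thesis
        by (rule that)
    qed
  qed
  interpret Metric_space UNIV d
    by (rule ms)
  have "d x y \<le> K / \<Lambda> ^ n" if TT: "T \<in> n_tiles f C n" "x \<in> T" "y \<in> T" for n T x y
  proof -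
    obtain B where "\<And>x y. x \<in> T \<Longrightarrow> y \<in> T \<Longrightarrow> d x y \<le> B"
      using T[OF TT(1)] by (auto simp: mbounded_alt)
    then have "bdd_above {d x y | x y. x \<in> T \<and> y \<in> T}"
      by (intro bdd_aboveI[of _ B]) auto
    then have "d x y \<le> diam d T"
      unfolding diam_def using TT(2,3) by (intro cSup_upper) auto
    then show ?thesis
      using T[OF TT(1)] by linarith
  qed
  with ms C show thesis
    using that by blast
qed

text \<open>Take \<open>n\<close> so large that all \<open>n\<close>-tiles have diameter less than \<open>e\<close>, and remove from the sphere the
  finitely many \<open>n\<close>-tiles that do not contain \<open>x\<close>. Every remaining point shares a tile with \<open>x\<close>.\<close>

lemma visual_metric_locally_small:
  fixes f :: "'a::topological_space \<Rightarrow> 'a"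
  assumes sph: "oriented_sphere \<A>" and bc: "branched_covering \<A> f"
    and vm: "visual_metric \<A> f d" and "e > 0"
  shows "\<exists>U. open U \<and> x \<in> U \<and> (\<forall>y\<in>U. d x y < e)"
proof -
  obtain \<Lambda> C K where C: "\<Lambda> > 1" "Jordan_curve C" "K \<ge> 1" and
    T: "\<And>n T x y. T \<in> n_tiles f C n \<Longrightarrow> x \<in> T \<Longrightarrow> y \<in> T \<Longrightarrow> d x y \<le> K / \<Lambda> ^ n"
    using visual_metric_tiles[OF vm] by metis
  obtain n where n: "K / e < \<Lambda> ^ n"
    using real_arch_pow[OF C(1)] by blast
  then have small: "K / \<Lambda> ^ n < e"
    using \<open>e > 0\<close> C by (simp add: field_simps)
  note tiles = n_tiles_finite_cover[OF sph bc C(2), of n]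
  define U where "U = - \<Union> {T \<in> n_tiles f C n. x \<notin> T}"
  have "open U"
    unfolding U_def using tiles(1) by (intro open_Compl closed_Union) (auto simp: n_tiles_def)
  moreover have "x \<in> U"
    by (auto simp: U_def)
  moreover have "d x y < e" if "y \<in> U" for y
  proof -
    obtain S where S: "S \<in> n_tiles f C n" "y \<in> S"
      using tiles(2) by blast
    then have "x \<in> S"
      using that by (auto simp: U_def)
    with T[OF S(1) this S(2)] small show ?thesis
      by simp
  qed
  ultimately show ?thesis
    by blast
qed

lemma visual_metric_bounded:
  fixes f :: "'a::topological_space \<Rightarrow> 'a"
  assumes sph: "oriented_sphere \<A>" and bc: "branched_covering \<A> f"
    and vm: "visual_metric \<A> f d"
  shows "bdd_above {d x y | x y. x \<in> UNIV \<and> y \<in> UNIV}"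
proof -
  obtain \<Lambda> C K where ms: "Metric_space UNIV d" and C: "Jordan_curve C" and
    T: "\<And>n T x y. T \<in> n_tiles f C n \<Longrightarrow> x \<in> T \<Longrightarrow> y \<in> T \<Longrightarrow> d x y \<le> K / \<Lambda> ^ n"
    using visual_metric_tiles[OF vm] by metis
  interpret Metric_space UNIV d
    by (rule ms)
  note tiles = n_tiles_finite_cover[OF sph bc C(1), of 0]
  have "mbounded S" if "S \<in> n_tiles f C 0" for S
    using T[OF that] by (auto simp: mbounded_alt)
  then have "mbounded UNIV"
    using mbounded_Union[OF tiles(1)] tiles(2) by simp
  then obtain B where "\<And>x y. d x y \<le> B"
    by (auto simp: mbounded_alt)
  then show ?thesis
    by (intro bdd_aboveI[of _ B]) auto
qed

section \<open>Hoelder functions for a visual metric\<close>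

lemma Lip_bound:
  assumes "Metric_space UNIV d" "\<psi> \<in> Lip d \<alpha>"
  shows "\<bar>\<psi> x - \<psi> y\<bar> \<le> lip_seminorm d \<alpha> \<psi> * d x y powr \<alpha>"
proof (cases "x = y")
  case False
  interpret Metric_space UNIV d
    by (rule assms(1))
  have "\<bar>\<psi> x - \<psi> y\<bar> / d x y powr \<alpha> \<le> lip_seminorm d \<alpha> \<psi>"
    unfolding lip_seminorm_def using assms(2) False
    by (intro cSup_upper) (auto simp: Lip_def difference_quotients_def)
  moreover have "d x y > 0"
    using False by (simp add: mdist_pos_less)
  ultimately show ?thesis
    by (simp add: pos_divide_le_eq)
next
  case True
  then show ?thesis
    using Metric_space.mdist_zero[OF assms(1)] by simp
qed

lemma Lip_intro:
  fixes d :: "'a \<Rightarrow> 'a \<Rightarrow> real"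
  assumes ms: "Metric_space UNIV d" and ne: "\<exists>x y::'a. x \<noteq> y"
    and le: "\<And>x y. \<bar>\<psi> x - \<psi> y\<bar> \<le> L * d x y powr \<alpha>"
  shows "\<psi> \<in> Lip d \<alpha>" "lip_seminorm d \<alpha> \<psi> \<le> L"
proof -
  interpret Metric_space UNIV d
    by (rule ms)
  have *: "q \<le> L" if q: "q \<in> difference_quotients d \<alpha> \<psi>" for q
  proof -
    from q obtain x y where xy: "q = \<bar>\<psi> x - \<psi> y\<bar> / d x y powr \<alpha>" "x \<noteq> y"
      by (auto simp: difference_quotients_def)
    then have "d x y > 0"
      by (simp add: mdist_pos_less)
    then show ?thesis
      using le[of x y] xy(1) by (simp add: pos_divide_le_eq)
  qed
  then show "\<psi> \<in> Lip d \<alpha>"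
    by (auto simp: Lip_def intro!: bdd_aboveI[of _ L])
  show "lip_seminorm d \<alpha> \<psi> \<le> L"
    unfolding lip_seminorm_def using * ne
    by (intro cSup_least) (auto simp: difference_quotients_def)
qed

lemma Lip_continuous:
  fixes f :: "'a::topological_space \<Rightarrow> 'a"
  assumes sph: "oriented_sphere \<A>" and bc: "branched_covering \<A> f"
    and vm: "visual_metric \<A> f d" and "0 < \<alpha>" and \<psi>: "\<psi> \<in> Lip d \<alpha>"
  shows "continuous_on UNIV \<psi>"
  unfolding continuous_on_topological
proof (intro ballI allI impI)
  fix x B assume B: "open B" "\<psi> x \<in> B"
  then obtain e where e: "e > 0" "\<And>t. \<bar>t - \<psi> x\<bar> < e \<Longrightarrow> t \<in> B"
    by (metis open_real_def dist_real_def open_dist)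
  have ms: "Metric_space UNIV d"
    using visual_metric_tiles[OF vm] by metis
  interpret Metric_space UNIV d
    by (rule ms)
  define L where "L = \<bar>lip_seminorm d \<alpha> \<psi>\<bar> + 1"
  \<comment> \<open>chosen so that \<open>L \<cdot> r\<^sup>\<alpha> = e\<close>; the summand \<open>1\<close> in \<open>L\<close> makes \<open>L\<close> positive\<close>
  define r where "r = (e / L) powr (1 / \<alpha>)"
  have "L > 0"
    by (simp add: L_def add_nonneg_pos)
  then have "r > 0"
    using e(1) by (simp add: r_def)
  then obtain U where U: "open U" "x \<in> U" "\<And>y. y \<in> U \<Longrightarrow> d x y < r"
    using visual_metric_locally_small[OF sph bc vm, of r x] by blast
  have "\<psi> y \<in> B" if "y \<in> U" for y
  proof (rule e(2))
    have "\<bar>\<psi> x - \<psi> y\<bar> \<le> lip_seminorm d \<alpha> \<psi> * d x y powr \<alpha>"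
      by (rule Lip_bound[OF ms \<psi>])
    also have "\<dots> \<le> L * d x y powr \<alpha>"
      by (intro mult_right_mono) (auto simp: L_def)
    also have "d x y powr \<alpha> < r powr \<alpha>"
      using U(3)[OF that] \<open>0 < \<alpha>\<close> by (intro powr_less_mono2) auto
    then have "L * d x y powr \<alpha> < L * r powr \<alpha>"
      using \<open>L > 0\<close> by simp
    also have "L * r powr \<alpha> = e"
      using \<open>0 < \<alpha>\<close> e(1) \<open>L > 0\<close> by (simp add: r_def powr_powr)
    finally show "\<bar>\<psi> y - \<psi> x\<bar> < e"
      by (simp add: abs_minus_commute)
  qed
  with U(1,2) show "\<exists>A. open A \<and> x \<in> A \<and> (\<forall>y\<in>UNIV. y \<in> A \<longrightarrow> \<psi> y \<in> B)"
    by blast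
qed

section \<open>Invariant measures from orbit averages\<close>

lemma space_filling_curve:
  fixes h :: "'a::topological_space \<Rightarrow> real^3"
  assumes hg: "homeomorphism (UNIV :: 'a set) (sphere (0 :: real^3) 1) h g"
  obtains \<gamma> :: "real \<Rightarrow> 'a" where "continuous_on UNIV \<gamma>" "\<gamma> ` {0..1} = UNIV"
proof -
  obtain c :: "real \<Rightarrow> real^3"
    where c: "continuous_on UNIV c" "c ` {0..1} = sphere 0 1" "range c \<subseteq> sphere 0 1"
    by (rule space_filling_curve_sphere)
  have "continuous_on UNIV (g \<circ> c)"
    by (rule continuous_on_compose[OF c(1) continuous_on_subset[OF homeomorphism_cont2[OF hg] c(3)]])
  moreover have "(g \<circ> c) ` {0..1} = UNIV"
    using c(2) homeomorphism_image2[OF hg] by (simp only: image_comp[symmetric])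
  ultimately show ?thesis
    by (rule that)
qed

lemma continuous_imp_bounded_on_compact_space:
  fixes G :: "'a::topological_space \<Rightarrow> real"
  assumes "compact (UNIV :: 'a set)" "continuous_on UNIV G"
  obtains B where "\<And>x. \<bar>G x\<bar> \<le> B"
proof -
  have "bounded (range G)"
    using compact_continuous_image[OF assms(2,1)] compact_imp_bounded by blast
  then show ?thesis
    using that by (auto simp: bounded_iff)
qed

text \<open>The indicator of an open set \<open>U\<close> is the limit of the continuous functions \<open>min 1 (k \<cdot> dist (h x) F)\<close>,
  where \<open>F\<close> is the image of the complement of \<open>U\<close> under the embedding \<open>h\<close>. So the two measures agree
  on open sets, which form an intersection-stable generator.\<close>

lemma borel_measure_eqI_continuous:
  fixes h :: "'a::topological_space \<Rightarrow> 'b::metric_space"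
  assumes cpt: "compact (UNIV :: 'a set)" and h: "continuous_on UNIV h" "inj h"
    and \<mu>: "prob_space \<mu>" "sets \<mu> = sets borel" and \<nu>: "prob_space \<nu>" "sets \<nu> = sets borel"
    and eq: "\<And>G :: 'a \<Rightarrow> real. continuous_on UNIV G \<Longrightarrow> (\<integral>x. G x \<partial>\<mu>) = (\<integral>x. G x \<partial>\<nu>)"
  shows "\<mu> = \<nu>"
proof -
  interpret M: prob_space \<mu>
    by (rule \<mu>(1))
  interpret N: prob_space \<nu>
    by (rule \<nu>(1))
  have space: "space \<mu> = UNIV" "space \<nu> = UNIV"
    using sets_eq_imp_space_eq[OF \<mu>(2)] sets_eq_imp_space_eq[OF \<nu>(2)] by simp_all
  \<comment> \<open>the whole space is treated apart, because \<open>infdist\<close> to the empty set is \<open>0\<close>\<close>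
  have open_eq: "emeasure \<mu> U = emeasure \<nu> U" if "open U" for U
  proof (cases "U = UNIV")
    case True
    then show ?thesis
      using M.emeasure_space_1 N.emeasure_space_1 space by simp
  next
    case False
    define F where "F = h ` (- U)"
    have "compact (- U)"
      using compact_Int_closed[OF cpt closed_Compl[OF that]] by simp
    then have "compact F"
      unfolding F_def
      by (rule compact_continuous_image[OF continuous_on_subset[OF h(1) subset_UNIV]])
    then have F: "closed F" "F \<noteq> {}"
      using False by (simp_all add: compact_imp_closed) (auto simp: F_def)
    have hF: "h x \<in> F \<longleftrightarrow> x \<notin> U" for x
      using h(2) by (auto simp: F_def inj_def)
    define G where "G k x = min 1 (real k * infdist (h x) F)" for k x
    have G_cont: "continuous_on UNIV (G k)" for k
      unfolding G_def using h(1) by (intro continuous_intros continuous_on_infdist)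
    have G_lim: "(\<lambda>k. G k x) \<longlonglongrightarrow> indicator U x" for x
    proof (cases "x \<in> U")
      case True
      then have pos: "infdist (h x) F > 0"
        using hF F infdist_nonneg[of "h x" F] in_closed_iff_infdist_zero[OF F] by force
      obtain m where m: "1 / infdist (h x) F < real m"
        using reals_Archimedean2 by blast
      have "G k x = 1" if "k \<ge> m" for k
      proof -
        have "1 \<le> real m * infdist (h x) F"
          using m pos by (simp add: field_simps)
        also have "\<dots> \<le> real k * infdist (h x) F"
          using that pos by (intro mult_right_mono) auto
        finally show ?thesis
          by (simp add: G_def)
      qed
      then have "eventually (\<lambda>k. G k x = indicator U x) sequentially"
        using True by (auto simp: eventually_sequentially)
      then show ?thesis
        by (rule tendsto_eventually)
    next
      case False
      then have "infdist (h x) F = 0"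
        using hF by simp
      then have "G k x = 0" for k
        by (simp add: G_def)
      with False show ?thesis
        by simp
    qed
    have G_bd: "norm (G k x) \<le> 1" for k x
      by (auto simp: G_def infdist_nonneg)
    have lim: "(\<lambda>k. \<integral>x. G k x \<partial>\<rho>) \<longlonglongrightarrow> (\<integral>x. indicator U x \<partial>\<rho>)"
      if "prob_space \<rho>" and s: "sets \<rho> = sets borel" for \<rho> :: "'a measure"
    proof -
      interpret R: prob_space \<rho>
        by (rule that(1))
      have meas: "borel_measurable \<rho> = borel_measurable (borel :: 'a measure)"
        by (rule measurable_cong_sets[OF s refl])
      show ?thesis
      proof (rule integral_dominated_convergence[where w = "\<lambda>_. 1"])
        show "(indicator U :: 'a \<Rightarrow> real) \<in> borel_measurable \<rho>"
          unfolding meas using \<open>open U\<close> by (intro borel_measurable_indicator borel_open)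
        show "G k \<in> borel_measurable \<rho>" for k
          unfolding meas by (rule borel_measurable_continuous_onI[OF G_cont])
      qed (use G_lim G_bd in auto)
    qed
    have "(\<integral>x. indicator U x \<partial>\<mu>) = (\<integral>x. indicator U x \<partial>\<nu> :: real)"
      using LIMSEQ_unique[OF lim[OF \<mu>]] lim[OF \<nu>] by (simp only: eq[OF G_cont])
    then have "measure \<mu> U = measure \<nu> U"
      using space by simp
    then show ?thesis
      by (simp add: M.emeasure_eq_measure N.emeasure_eq_measure)
  qed
  have borel: "sets (borel :: 'a measure) = sigma_sets UNIV {S. open S}"
    unfolding borel_def by simp
  show ?thesis
  proof (rule measure_eqI_generator_eq[where E = "{S. open S}" and \<Omega> = UNIV and A = "\<lambda>_. UNIV"])
    show "Int_stable {S :: 'a set. open S}"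
      by (auto simp: Int_stable_def)
    show "emeasure \<mu> UNIV \<noteq> \<infinity>" for i :: nat
      by simp
  qed (use open_eq borel \<mu> \<nu> in auto)
qed

lemma invariant_integral_funpow:
  fixes f :: "'a::topological_space \<Rightarrow> 'a" and G :: "'a \<Rightarrow> real"
  assumes \<mu>: "\<mu> \<in> invariant_measures f" and f: "continuous_on UNIV f" and G: "continuous_on UNIV G"
  shows "(\<integral>x. G ((f ^^ i) x) \<partial>\<mu>) = (\<integral>x. G x \<partial>\<mu>)"
proof (induction i)
  case (Suc i)
  have s: "sets \<mu> = sets borel" and inv: "distr \<mu> borel f = \<mu>"
    using \<mu> by (auto simp: invariant_measures_def)
  have fm: "f \<in> measurable \<mu> borel"
    unfolding measurable_cong_sets[OF s refl] by (rule borel_measurable_continuous_onI[OF f])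
  have "continuous_on UNIV (\<lambda>x. G ((f ^^ i) x))"
    by (rule continuous_on_compose2[OF G funpow_continuous[OF f]]) simp
  then have Gm: "(\<lambda>x. G ((f ^^ i) x)) \<in> borel_measurable borel"
    by (rule borel_measurable_continuous_onI)
  have "(\<integral>x. G ((f ^^ Suc i) x) \<partial>\<mu>) = (\<integral>x. G ((f ^^ i) (f x)) \<partial>\<mu>)"
    by (simp only: funpow_Suc_right comp_apply)
  also have "\<dots> = (\<integral>x. G ((f ^^ i) x) \<partial>distr \<mu> borel f)"
    by (rule integral_distr[OF fm Gm, symmetric])
  also have "\<dots> = (\<integral>x. G x \<partial>\<mu>)"
    by (simp only: inv Suc)
  finally show ?case .
qed simp

text \<open>Sequential compactness of the empirical measures of orbit pieces. Let \<open>s\<close> be a section of the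
  space-filling curve \<open>\<gamma>\<close>. The lifted measures \<open>\<nu> k\<close>, uniform on the points \<open>s (f\<^sup>i x)\<close>, live on \<open>[0, 1]\<close>
  and are therefore tight. A weak limit is pushed forward by \<open>\<gamma>\<close>; continuity of \<open>\<gamma>\<close> turns a continuous
  test function on the sphere into one on the line. The section \<open>s\<close> is merely a function: each \<open>\<nu> k\<close> is
  the image of a measure on a finite set.\<close>

lemma empirical_limit_measure:
  fixes f :: "'a::topological_space \<Rightarrow> 'a" and h :: "'a \<Rightarrow> real^3"
  assumes hg: "homeomorphism (UNIV :: 'a set) (sphere (0 :: real^3) 1) h g"
    and N: "\<And>k. N k \<ge> (1::nat)"
  obtains r \<mu> where "strict_mono (r :: nat \<Rightarrow> nat)" "prob_space \<mu>" "sets \<mu> = sets borel"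
    "\<And>G :: 'a \<Rightarrow> real. continuous_on UNIV G \<Longrightarrow>
      (\<lambda>k. (\<Sum>i<N (r k). G ((f ^^ i) (x (r k)))) / N (r k)) \<longlonglongrightarrow> (\<integral>y. G y \<partial>\<mu>)"
proof -
  obtain \<gamma> :: "real \<Rightarrow> 'a" where \<gamma>: "continuous_on UNIV \<gamma>" "\<gamma> ` {0..1} = UNIV"
    by (rule space_filling_curve[OF hg])
  have "\<forall>y. \<exists>t. t \<in> {0..1} \<and> \<gamma> t = y"
    using \<gamma>(2) by (metis UNIV_I imageE)
  then obtain s where s: "\<And>y. s y \<in> {0..1}" "\<And>y. \<gamma> (s y) = y"
    by metis
  define p where "p k = measure_pmf (pmf_of_set {..<N k})" for k
  define \<nu> where "\<nu> k = distr (p k) borel (\<lambda>i. s ((f ^^ i) (x k)))" for k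
  have meas: "(\<lambda>i. s ((f ^^ i) (x k))) \<in> measurable (p k) borel" for k
    by (simp add: p_def)
  have rd: "real_distribution (\<nu> k)" for k
  proof -
    have "prob_space (p k)"
      unfolding p_def by (rule prob_space_measure_pmf)
    then have "prob_space (\<nu> k)"
      unfolding \<nu>_def by (rule prob_space.prob_space_distr[OF _ meas])
    then show ?thesis
      by (auto simp: real_distribution_def real_distribution_axioms_def \<nu>_def)
  qed
  \<comment> \<open>tightness is formulated with half-open intervals, so \<open>[0, 1]\<close> is enlarged to \<open>(-1, 1]\<close>\<close>
  have "measure (\<nu> k) {-1<..1} = 1" for k
  proof -
    have s': "- 1 < s y" "s y \<le> 1" for y
      using s(1)[of y] by auto
    have "(\<lambda>i. s ((f ^^ i) (x k))) -` {-1<..1} \<inter> space (p k) = space (p k)"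
      using s' by auto
    then have "measure (\<nu> k) {-1<..1} = measure (p k) (space (p k))"
      unfolding \<nu>_def by (subst measure_distr[OF meas]) auto
    then show ?thesis
      unfolding p_def by simp
  qed
  then have "tight \<nu>"
    unfolding tight_def
    using rd by (intro conjI allI impI exI[of _ "-1::real"] exI[of _ "1::real"]) simp_all
  then obtain r M where r: "strict_mono (r :: nat \<Rightarrow> nat)" and M: "real_distribution M"
    and conv: "weak_conv_m (\<nu> \<circ> id \<circ> r) M"
    using tight_imp_convergent_subsubsequence[of \<nu> id] by (auto simp: strict_mono_def)
  interpret M: real_distribution M
    by (rule M)
  have \<gamma>m: "\<gamma> \<in> measurable M borel"
    unfolding measurable_cong_sets[OF M.events_eq_borel refl]
    by (rule borel_measurable_continuous_onI[OF \<gamma>(1)])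
  define \<mu> where "\<mu> = distr M borel \<gamma>"
  have "prob_space \<mu>"
    unfolding \<mu>_def by (rule M.prob_space_distr[OF \<gamma>m])
  moreover have "sets \<mu> = sets borel"
    by (simp add: \<mu>_def)
  moreover have "(\<lambda>k. (\<Sum>i<N (r k). G ((f ^^ i) (x (r k)))) / N (r k)) \<longlonglongrightarrow> (\<integral>y. G y \<partial>\<mu>)"
    if G: "continuous_on UNIV G" for G :: "'a \<Rightarrow> real"
  proof -
    obtain B where B: "\<And>y. \<bar>G y\<bar> \<le> B"
      using continuous_imp_bounded_on_compact_space[OF sphere_homeomorphism_imp(1)[OF hg] G] by blast
    have G\<gamma>: "continuous_on UNIV (\<lambda>t. G (\<gamma> t))"
      by (rule continuous_on_compose2[OF G \<gamma>(1)]) simp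
    have "(\<lambda>k. \<integral>t. G (\<gamma> t) \<partial>(\<nu> \<circ> id \<circ> r) k) \<longlonglongrightarrow> (\<integral>t. G (\<gamma> t) \<partial>M)"
    proof (rule weak_conv_imp_integral_bdd_continuous_conv[OF _ M conv])
      show "real_distribution ((\<nu> \<circ> id \<circ> r) n)" for n
        using rd by simp
      show "isCont (\<lambda>t. G (\<gamma> t)) t" for t
        using G\<gamma> by (simp add: continuous_on_eq_continuous_at)
      show "norm (G (\<gamma> t)) \<le> B" for t
        using B by simp
    qed
    moreover have "(\<integral>t. G (\<gamma> t) \<partial>\<nu> k) = (\<Sum>i<N k. G ((f ^^ i) (x k))) / N k" for k
    proof -
      have "(\<integral>t. G (\<gamma> t) \<partial>\<nu> k) = (\<integral>i. G (\<gamma> (s ((f ^^ i) (x k)))) \<partial>p k)"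
        unfolding \<nu>_def
        by (rule integral_distr[OF meas borel_measurable_continuous_onI[OF G\<gamma>]])
      also have "\<dots> = (\<Sum>i<N k. G ((f ^^ i) (x k))) / N k"
        unfolding p_def s(2) using N[of k] by (subst integral_pmf_of_set) (auto simp: lessThan_empty_iff)
      finally show ?thesis .
    qed
    moreover have "(\<integral>t. G (\<gamma> t) \<partial>M) = (\<integral>y. G y \<partial>\<mu>)"
      unfolding \<mu>_def by (rule integral_distr[OF \<gamma>m borel_measurable_continuous_onI[OF G], symmetric])
    ultimately show ?thesis
      by simp
  qed
  ultimately show thesis
    using that r by blast
qed

text \<open>The Krylov-Bogolyubov argument. Replacing \<open>G\<close> by \<open>G \<circ> f\<close> changes its sum over an orbit piece only by
  the two boundary terms, so the averages over pieces of growing length have the same limit and the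
  limit measure is invariant.\<close>

lemma invariant_measure_of_orbit_averages:
  fixes f :: "'a::topological_space \<Rightarrow> 'a" and h :: "'a \<Rightarrow> real^3"
  assumes hg: "homeomorphism (UNIV :: 'a set) (sphere (0 :: real^3) 1) h g"
    and f: "continuous_on UNIV f" and \<phi>: "continuous_on UNIV \<phi>"
    and N: "\<And>k. N k \<ge> (1::nat)" "filterlim N at_top sequentially"
    and avg: "\<And>k. c * real (N k) \<le> (\<Sum>i<N k. \<phi> ((f ^^ i) (x k)))"
  shows "\<exists>\<mu>\<in>invariant_measures f. c \<le> (\<integral>y. \<phi> y \<partial>\<mu>)"
proof -
  note cpt = sphere_homeomorphism_imp(1)[OF hg]
  obtain r \<mu> where r: "strict_mono (r :: nat \<Rightarrow> nat)" and \<mu>: "prob_space \<mu>" "sets \<mu> = sets borel"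
    and lim: "\<And>G :: 'a \<Rightarrow> real. continuous_on UNIV G \<Longrightarrow>
      (\<lambda>k. (\<Sum>i<N (r k). G ((f ^^ i) (x (r k)))) / N (r k)) \<longlonglongrightarrow> (\<integral>y. G y \<partial>\<mu>)"
    by (rule empirical_limit_measure[where f = f and x = x and N = N, OF hg N(1)]) (rule that)
  interpret prob_space \<mu>
    by (rule \<mu>(1))
  have fm: "f \<in> measurable \<mu> borel"
    unfolding measurable_cong_sets[OF \<mu>(2) refl] by (rule borel_measurable_continuous_onI[OF f])
  have Nr: "filterlim (\<lambda>k. real (N (r k))) at_top sequentially"
    using filterlim_compose[OF N(2) filterlim_subseq[OF r]]
    by (rule filterlim_compose[OF filterlim_real_sequentially])
  have "(\<integral>y. G (f y) \<partial>\<mu>) = (\<integral>y. G y \<partial>\<mu>)" if G: "continuous_on UNIV G" for G :: "'a \<Rightarrow> real"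
  proof -
    obtain B where B: "\<And>y. \<bar>G y\<bar> \<le> B"
      using continuous_imp_bounded_on_compact_space[OF cpt G] by blast
    have "continuous_on UNIV (\<lambda>y. G (f y))"
      by (rule continuous_on_compose2[OF G f]) simp
    from tendsto_diff[OF lim[OF this] lim[OF G]]
    have "(\<lambda>k. (G ((f ^^ N (r k)) (x (r k))) - G (x (r k))) / N (r k))
        \<longlonglongrightarrow> (\<integral>y. G (f y) \<partial>\<mu>) - (\<integral>y. G y \<partial>\<mu>)"
    proof (rule back_subst[where P = "\<lambda>X. X \<longlonglongrightarrow> _"], intro ext)
      fix k
      have "(\<Sum>i<n. G (f ((f ^^ i) z))) - (\<Sum>i<n. G ((f ^^ i) z)) = G ((f ^^ n) z) - G z" for n z
        by (induction n) auto
      then show "(\<Sum>i<N (r k). G (f ((f ^^ i) (x (r k))))) / N (r k)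
          - (\<Sum>i<N (r k). G ((f ^^ i) (x (r k)))) / N (r k)
        = (G ((f ^^ N (r k)) (x (r k))) - G (x (r k))) / N (r k)"
        by (simp only: diff_divide_distrib[symmetric])
    qed
    moreover have "(\<lambda>k. (G ((f ^^ N (r k)) (x (r k))) - G (x (r k))) / N (r k)) \<longlonglongrightarrow> 0"
    proof (rule Lim_null_comparison)
      show "(\<lambda>k. 2 * B / real (N (r k))) \<longlonglongrightarrow> 0"
        by (rule real_tendsto_divide_at_top[OF tendsto_const Nr])
      have "\<bar>G y - G z\<bar> \<le> 2 * B" for y z
        using B[of y] B[of z] by linarith
      then show "\<forall>\<^sub>F k in sequentially. norm ((G ((f ^^ N (r k)) (x (r k))) - G (x (r k))) / N (r k))
          \<le> 2 * B / real (N (r k))"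
        by (intro always_eventually allI) (simp add: divide_right_mono)
    qed
    ultimately have "(\<integral>y. G (f y) \<partial>\<mu>) - (\<integral>y. G y \<partial>\<mu>) = 0"
      by (rule LIMSEQ_unique)
    then show ?thesis
      by simp
  qed
  then have "(\<integral>y. G y \<partial>distr \<mu> borel f) = (\<integral>y. G y \<partial>\<mu>)" if "continuous_on UNIV G" for G :: "'a \<Rightarrow> real"
    using that integral_distr[OF fm borel_measurable_continuous_onI[OF that]] by simp
  moreover have "continuous_on UNIV h" "inj h"
    using hg by (auto simp: homeomorphism_def intro: inj_on_inverseI)
  ultimately have "distr \<mu> borel f = \<mu>"
    using prob_space_distr[OF fm] by (intro borel_measure_eqI_continuous[OF cpt, of h] \<mu>) auto
  then have "\<mu> \<in> invariant_measures f"
    using \<mu> by (simp add: invariant_measures_def)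
  moreover have "c \<le> (\<integral>y. \<phi> y \<partial>\<mu>)"
  proof (rule LIMSEQ_le_const[OF lim[OF \<phi>]], intro exI allI impI)
    fix k
    have "real (N (r k)) > 0"
      using N(1)[of "r k"] by linarith
    then show "c \<le> (\<Sum>i<N (r k). \<phi> ((f ^^ i) (x (r k)))) / N (r k)"
      using avg[of "r k"] by (simp add: pos_le_divide_eq)
  qed
  ultimately show ?thesis
    by blast
qed

text \<open>Put \<open>c = inf\<^sub>n (max S\<^sub>n \<phi>) / n\<close> for the Birkhoff sums \<open>S\<^sub>n \<phi>\<close>. Integrating \<open>S\<^sub>n \<phi> \<le> max S\<^sub>n \<phi>\<close> shows that
  no invariant measure has integral above \<open>c\<close>, and orbit pieces starting at maximum points of \<open>S\<^sub>n \<phi>\<close>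
  give one with integral at least \<open>c\<close>. Hence \<open>c\<close> is the maximal average, and in particular the
  greatest integral in its definition exists.\<close>

lemma max_average_birkhoff:
  fixes f :: "'a::topological_space \<Rightarrow> 'a" and h :: "'a \<Rightarrow> real^3"
  assumes hg: "homeomorphism (UNIV :: 'a set) (sphere (0 :: real^3) 1) h g"
    and f: "continuous_on UNIV f" and \<phi>: "continuous_on UNIV \<phi>"
  shows "\<And>\<mu>. \<mu> \<in> invariant_measures f \<Longrightarrow> (\<integral>y. \<phi> y \<partial>\<mu>) \<le> max_average f \<phi>"
    and "\<And>n. \<exists>x. real n * max_average f \<phi> \<le> (\<Sum>i<n. \<phi> ((f ^^ i) x))"
proof -
  note cpt = sphere_homeomorphism_imp(1)[OF hg]
  define S where "S n x = (\<Sum>i<n. \<phi> ((f ^^ i) x))" for n x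
  have S_cont: "continuous_on UNIV (S n)" for n
    unfolding S_def
    by (intro continuous_on_sum continuous_on_compose2[OF \<phi> funpow_continuous[OF f]]) simp
  have "\<exists>x. \<forall>y. S n y \<le> S n x" for n
    using continuous_attains_sup[OF cpt _ S_cont] by auto
  then obtain x where x: "\<And>n y. S n y \<le> S n (x n)"
    by metis
  obtain B where B: "\<And>y. \<bar>\<phi> y\<bar> \<le> B"
    using continuous_imp_bounded_on_compact_space[OF cpt \<phi>] by blast
  have S_lower: "- (real n * B) \<le> S n y" for n y
  proof -
    have "(\<Sum>i<n. - B) \<le> S n y"
      unfolding S_def using B by (intro sum_mono) (simp add: abs_le_iff minus_le_iff)
    then show ?thesis
      by simp
  qed
  \<comment> \<open>the index is shifted to avoid division by zero\<close>
  define c where "c = (INF k. S (Suc k) (x (Suc k)) / real (Suc k))"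
  have "bdd_below (range (\<lambda>k. S (Suc k) (x (Suc k)) / real (Suc k)))"
  proof (rule bdd_belowI2[where m = "- B"])
    show "- B \<le> S (Suc k) (x (Suc k)) / real (Suc k)" for k
      using S_lower[of "Suc k" "x (Suc k)"] by (simp add: field_simps)
  qed
  then have c_le: "c \<le> S (Suc k) (x (Suc k)) / real (Suc k)" for k
    unfolding c_def by (rule cINF_lower) simp
  then have c_le': "c * real (Suc k) \<le> S (Suc k) (x (Suc k))" for k
    using c_le[of k] by (simp only: pos_le_divide_eq of_nat_0_less_iff zero_less_Suc)
  have "\<exists>\<mu>\<in>invariant_measures f. c \<le> (\<integral>y. \<phi> y \<partial>\<mu>)"
  proof (rule invariant_measure_of_orbit_averages[OF hg f \<phi>, of Suc c "\<lambda>k. x (Suc k)"])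
    show "filterlim Suc at_top sequentially"
      by (rule filterlim_Suc)
    show "c * real (Suc k) \<le> (\<Sum>i<Suc k. \<phi> ((f ^^ i) (x (Suc k))))" for k
      using c_le'[of k] unfolding S_def .
  qed simp
  then obtain \<mu>0 where \<mu>0: "\<mu>0 \<in> invariant_measures f" "c \<le> (\<integral>y. \<phi> y \<partial>\<mu>0)"
    by blast
  have upper: "(\<integral>y. \<phi> y \<partial>\<mu>) \<le> c" if \<mu>: "\<mu> \<in> invariant_measures f" for \<mu>
    unfolding c_def
  proof (rule cINF_greatest)
    fix k
    have ps: "prob_space \<mu>" and s: "sets \<mu> = sets borel"
      using \<mu> by (auto simp: invariant_measures_def)
    interpret prob_space \<mu>
      by (rule ps)
    have int: "integrable \<mu> G" if G: "continuous_on UNIV G" for G :: "'a \<Rightarrow> real"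
    proof -
      obtain B where "\<And>y. \<bar>G y\<bar> \<le> B"
        using continuous_imp_bounded_on_compact_space[OF cpt G] by blast
      moreover have "G \<in> borel_measurable \<mu>"
        unfolding measurable_cong_sets[OF s refl] by (rule borel_measurable_continuous_onI[OF G])
      ultimately show ?thesis
        by (intro integrable_const_bound[of _ B]) auto
    qed
    have "continuous_on UNIV (\<lambda>y. \<phi> ((f ^^ i) y))" for i
      by (rule continuous_on_compose2[OF \<phi> funpow_continuous[OF f]]) simp
    then have "(\<integral>y. S (Suc k) y \<partial>\<mu>) = (\<Sum>i<Suc k. \<integral>y. \<phi> ((f ^^ i) y) \<partial>\<mu>)"
      unfolding S_def by (intro Bochner_Integration.integral_sum int)
    also have "\<dots> = real (Suc k) * (\<integral>y. \<phi> y \<partial>\<mu>)"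
      unfolding invariant_integral_funpow[OF \<mu> f \<phi>] by simp
    finally have "real (Suc k) * (\<integral>y. \<phi> y \<partial>\<mu>) = (\<integral>y. S (Suc k) y \<partial>\<mu>)"
      by simp
    also have "\<dots> \<le> S (Suc k) (x (Suc k))"
      using x by (intro integral_le_const int S_cont) auto
    finally show "(\<integral>y. \<phi> y \<partial>\<mu>) \<le> S (Suc k) (x (Suc k)) / real (Suc k)"
      by (simp add: pos_le_divide_eq mult.commute del: of_nat_Suc)
  qed simp
  have max: "max_average f \<phi> = c"
    unfolding max_average_def
    by (rule Greatest_equality) (use \<mu>0 upper in \<open>auto intro!: bexI[of _ \<mu>0] antisym\<close>)
  show "(\<integral>y. \<phi> y \<partial>\<mu>) \<le> max_average f \<phi>" if "\<mu> \<in> invariant_measures f" for \<mu>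
    using upper[OF that] max by simp
  show "\<exists>y. real n * max_average f \<phi> \<le> (\<Sum>i<n. \<phi> ((f ^^ i) y))" for n
  proof (cases n)
    case (Suc k)
    then show ?thesis
      using c_le'[of k] max by (auto simp: S_def mult.commute intro!: exI[of _ "x n"])
  qed simp
qed

section \<open>Iterates of the Bousch operator\<close>

lemma bousch_set_finite:
  assumes "finite (f -` {x})"
  shows "finite {\<psi> y + u y | y. y \<in> f -` {x}}"
proof -
  have "{\<psi> y + u y | y. y \<in> f -` {x}} = (\<lambda>y. \<psi> y + u y) ` (f -` {x})"
    by auto
  with assms show ?thesis
    by simp
qed

lemma bousch_ge:
  assumes "finite (f -` {f y})"
  shows "\<psi> y + u y \<le> bousch f \<psi> u (f y)"
  unfolding bousch_def by (intro Max_ge bousch_set_finite assms) auto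

lemma bousch_attained:
  assumes "finite (f -` {x})" "surj f"
  shows "\<exists>y. f y = x \<and> bousch f \<psi> u x = \<psi> y + u y"
proof -
  have "bousch f \<psi> u x \<in> {\<psi> y + u y | y. y \<in> f -` {x}}"
    unfolding bousch_def
    using assms by (intro Max_in bousch_set_finite) (auto simp: surj_def, metis)
  then show ?thesis
    by auto
qed

lemma bousch_iterate_ge:
  assumes fin: "\<And>x. finite (f -` {x})"
  shows "(\<Sum>i<n. \<psi> ((f ^^ i) y)) \<le> (bousch f \<psi> ^^ n) (\<lambda>_. 0) ((f ^^ n) y)"
proof (induction n)
  case (Suc n)
  have "(\<Sum>i<Suc n. \<psi> ((f ^^ i) y))
      \<le> \<psi> ((f ^^ n) y) + (bousch f \<psi> ^^ n) (\<lambda>_. 0) ((f ^^ n) y)"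
    using Suc by simp
  also have "\<dots> \<le> bousch f \<psi> ((bousch f \<psi> ^^ n) (\<lambda>_. 0)) (f ((f ^^ n) y))"
    by (rule bousch_ge[OF fin])
  finally show ?case
    by simp
qed simp

lemma bousch_iterate_attained:
  assumes fin: "\<And>x. finite (f -` {x})" and "surj f"
  shows "\<exists>y. (f ^^ n) y = x \<and> (bousch f \<psi> ^^ n) (\<lambda>_. 0) x = (\<Sum>i<n. \<psi> ((f ^^ i) y))"
proof (induction n arbitrary: x)
  case (Suc n)
  obtain z where z: "f z = x" "bousch f \<psi> ((bousch f \<psi> ^^ n) (\<lambda>_. 0)) x = \<psi> z + (bousch f \<psi> ^^ n) (\<lambda>_. 0) z"
    using bousch_attained[OF fin \<open>surj f\<close>] by blast
  obtain y where y: "(f ^^ n) y = z" "(bousch f \<psi> ^^ n) (\<lambda>_. 0) z = (\<Sum>i<n. \<psi> ((f ^^ i) y))"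
    using Suc by blast
  show ?case
    by (intro exI[of _ y]) (simp add: y z)
qed simp

text \<open>A point with large Birkhoff sum supplies a large value of the iterate at its \<open>n\<close>-th image.\<close>

lemma bousch_iterates_nonneg_somewhere:
  fixes f :: "'a::topological_space \<Rightarrow> 'a" and h :: "'a \<Rightarrow> real^3"
  assumes hg: "homeomorphism (UNIV :: 'a set) (sphere (0 :: real^3) 1) h g"
    and f: "continuous_on UNIV f" and \<phi>: "continuous_on UNIV \<phi>"
    and fin: "\<And>x. finite (f -` {x})"
  shows "\<exists>x. 0 \<le> (bousch f (normalised f \<phi>) ^^ n) (\<lambda>_. 0) x"
proof -
  obtain y where "real n * max_average f \<phi> \<le> (\<Sum>i<n. \<phi> ((f ^^ i) y))"
    using max_average_birkhoff(2)[OF hg f \<phi>] by blast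
  then have "0 \<le> (\<Sum>i<n. normalised f \<phi> ((f ^^ i) y))"
    by (simp add: normalised_def sum_subtractf)
  also have "\<dots> \<le> (bousch f (normalised f \<phi>) ^^ n) (\<lambda>_. 0) ((f ^^ n) y)"
    by (rule bousch_iterate_ge[OF fin])
  finally show ?thesis
    by blast
qed

text \<open>Otherwise every point \<open>y\<close> is the \<open>n\<close>-th image of a point \<open>z\<close> whose Birkhoff sum of length \<open>n\<close> is at
  least \<open>e\<close>. Prepending such pieces repeatedly gives orbit pieces of length \<open>k n\<close> along which the
  average of \<open>\<phi>\<close> exceeds the maximal average by at least \<open>e / n\<close>, and a limit of their empirical
  measures contradicts maximality.\<close>

lemma bousch_iterates_small_somewhere:
  fixes f :: "'a::topological_space \<Rightarrow> 'a" and h :: "'a \<Rightarrow> real^3"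
  assumes hg: "homeomorphism (UNIV :: 'a set) (sphere (0 :: real^3) 1) h g"
    and f: "continuous_on UNIV f" and \<phi>: "continuous_on UNIV \<phi>"
    and fin: "\<And>x. finite (f -` {x})" and "surj f" and "n \<ge> 1" and "e > 0"
  shows "\<exists>x. (bousch f (normalised f \<phi>) ^^ n) (\<lambda>_. 0) x \<le> e"
proof (rule ccontr)
  define \<psi> where "\<psi> = normalised f \<phi>"
  assume "\<not> ?thesis"
  then have big: "e \<le> (bousch f \<psi> ^^ n) (\<lambda>_. 0) x" for x
    by (auto simp: \<psi>_def not_le intro: less_imp_le)
  have split: "(\<Sum>i<m + l. a i) = (\<Sum>i<m. a i) + (\<Sum>i<l. a (m + i))" for m l and a :: "nat \<Rightarrow> real"
    by (induction l) simp_all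
  have "\<exists>y. real k * e \<le> (\<Sum>i<k * n. \<psi> ((f ^^ i) y))" for k
  proof (induction k)
    case (Suc k)
    then obtain y where y: "real k * e \<le> (\<Sum>i<k * n. \<psi> ((f ^^ i) y))"
      by blast
    obtain z where z: "(f ^^ n) z = y" "(bousch f \<psi> ^^ n) (\<lambda>_. 0) y = (\<Sum>i<n. \<psi> ((f ^^ i) z))"
      using bousch_iterate_attained[OF fin \<open>surj f\<close>] by blast
    have "real (Suc k) * e \<le> (\<Sum>i<n. \<psi> ((f ^^ i) z)) + (\<Sum>i<k * n. \<psi> ((f ^^ i) y))"
      using big[of y] y z(2) by (simp add: algebra_simps)
    also have "(\<Sum>i<k * n. \<psi> ((f ^^ i) y)) = (\<Sum>i<k * n. \<psi> ((f ^^ (n + i)) z))"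
      by (simp add: z(1)[symmetric] add.commute[of n] funpow_add)
    also have "(\<Sum>i<n. \<psi> ((f ^^ i) z)) + (\<Sum>i<k * n. \<psi> ((f ^^ (n + i)) z))
        = (\<Sum>i<n + k * n. \<psi> ((f ^^ i) z))"
      by (rule split[symmetric])
    finally show ?case
      by auto
  qed simp
  then obtain x where x: "\<And>k. real k * e \<le> (\<Sum>i<k * n. \<psi> ((f ^^ i) (x k)))"
    by metis
  \<comment> \<open>the average of \<open>\<phi>\<close> that the chained orbit pieces attain\<close>
  define c where "c = max_average f \<phi> + e / n"
  have "\<exists>\<mu>\<in>invariant_measures f. c \<le> (\<integral>y. \<phi> y \<partial>\<mu>)"
  proof (rule invariant_measure_of_orbit_averages[OF hg f \<phi>, of "\<lambda>k. Suc k * n" c "\<lambda>k. x (Suc k)"])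
    show "1 \<le> Suc k * n" for k
      using \<open>n \<ge> 1\<close> by simp
    show "filterlim (\<lambda>k. Suc k * n) at_top sequentially"
    proof (rule filterlim_at_top_mono[OF filterlim_Suc])
      show "\<forall>\<^sub>F k in sequentially. Suc k \<le> Suc k * n"
        using mult_le_mono2[OF \<open>n \<ge> 1\<close>] by (intro always_eventually allI) (metis mult_1_right)
    qed
    show "c * real (Suc k * n) \<le> (\<Sum>i<Suc k * n. \<phi> ((f ^^ i) (x (Suc k))))" for k
    proof -
      have "(\<Sum>i<Suc k * n. \<psi> ((f ^^ i) (x (Suc k))))
          = (\<Sum>i<Suc k * n. \<phi> ((f ^^ i) (x (Suc k)))) - real (Suc k * n) * max_average f \<phi>"
        by (simp only: \<psi>_def normalised_def sum_subtractf sum_constant card_lessThan)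
      moreover have "c * real (Suc k * n) = real (Suc k * n) * max_average f \<phi> + real (Suc k) * e"
        using \<open>n \<ge> 1\<close> by (simp add: c_def field_simps)
      ultimately show ?thesis
        using x[of "Suc k"] by linarith
    qed
  qed
  then have "c \<le> max_average f \<phi>"
    using max_average_birkhoff(1)[OF hg f \<phi>] by force
  then show False
    using \<open>e > 0\<close> \<open>n \<ge> 1\<close> by (simp add: c_def divide_le_0_iff)
qed

text \<open>Iterate \<open>n + 1\<close> at \<open>x\<close> is a maximum over the fibre of \<open>x\<close> of values of iterate \<open>n\<close>. Keeping a single
  point of the fibre bounds the upper limit from below. For the bound from above, iterate \<open>n\<close> is
  eventually at most \<open>u + e\<close> at all points of the fibre simultaneously, because the fibre is finite.\<close>

lemma bousch_fixed_point_of_limsup: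
  fixes u :: "'a \<Rightarrow> real"
  assumes fin: "\<And>x. finite (f -` {x})" and "surj f"
    and u: "\<And>x. limsup (\<lambda>n. ereal ((bousch f \<psi> ^^ n) v x)) = ereal (u x)"
  shows "bousch f \<psi> u = u"
proof
  fix x
  define w where "w n = (bousch f \<psi> ^^ n) v" for n
  have u': "limsup (\<lambda>n. ereal (w n z)) = ereal (u z)" for z
    using u by (simp add: w_def)
  have shift: "limsup (\<lambda>n. ereal (w (Suc n) z)) = ereal (u z)" for z
    using u'[of z] limsup_shift[of "\<lambda>n. ereal (w n z)"] by simp
  have step: "w (Suc n) = bousch f \<psi> (w n)" for n
    by (simp add: w_def)
  have up: "u z \<le> r" if "\<forall>\<^sub>F n in sequentially. w (Suc n) z \<le> r" for z r
  proof -
    have "limsup (\<lambda>n. ereal (w (Suc n) z)) \<le> ereal r"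
      using that by (intro Limsup_bounded) simp
    then show ?thesis
      by (simp add: shift)
  qed
  show "bousch f \<psi> u x = u x"
  proof (rule antisym)
    obtain y where y: "f y = x" "bousch f \<psi> u x = \<psi> y + u y"
      using bousch_attained[OF fin \<open>surj f\<close>] by blast
    show "bousch f \<psi> u x \<le> u x"
    proof (rule field_le_epsilon)
      fix e :: real assume "0 < e"
      have "limsup (\<lambda>n. ereal (w (Suc n) x)) < ereal (u x + e)"
        using \<open>0 < e\<close> by (simp add: shift)
      then have "\<forall>\<^sub>F n in sequentially. ereal (w (Suc n) x) < ereal (u x + e)"
        by (rule Limsup_lessD)
      then have "\<forall>\<^sub>F n in sequentially. ereal (w n y) \<le> ereal (u x - \<psi> y + e)"
      proof (rule eventually_mono)
        fix n assume "ereal (w (Suc n) x) < ereal (u x + e)"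
        moreover have "\<psi> y + w n y \<le> w (Suc n) x"
          unfolding step using bousch_ge[where y = y and \<psi> = \<psi> and u = "w n", OF fin] y(1) by simp
        ultimately show "ereal (w n y) \<le> ereal (u x - \<psi> y + e)"
          by simp
      qed
      then have "limsup (\<lambda>n. ereal (w n y)) \<le> ereal (u x - \<psi> y + e)"
        by (rule Limsup_bounded)
      then show "bousch f \<psi> u x \<le> u x + e"
        using y(2) by (simp add: u')
    qed
  next
    show "u x \<le> bousch f \<psi> u x"
    proof (rule field_le_epsilon)
      fix e :: real assume "0 < e"
      have "\<forall>\<^sub>F n in sequentially. ereal (w n y) < ereal (u y + e)" for y
        using \<open>0 < e\<close> by (intro Limsup_lessD) (simp add: u')
      then have "\<forall>\<^sub>F n in sequentially. \<forall>y\<in>f -` {x}. w n y < u y + e"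
        using fin[of x] by (simp add: eventually_ball_finite)
      then have "\<forall>\<^sub>F n in sequentially. w (Suc n) x \<le> bousch f \<psi> u x + e"
      proof (rule eventually_mono)
        fix n assume *: "\<forall>y\<in>f -` {x}. w n y < u y + e"
        obtain y where y: "f y = x" "bousch f \<psi> (w n) x = \<psi> y + w n y"
          using bousch_attained[OF fin \<open>surj f\<close>] by blast
        have "w n y < u y + e"
          using * y(1) by simp
        moreover have "\<psi> y + u y \<le> bousch f \<psi> u x"
          using bousch_ge[where y = y and \<psi> = \<psi> and u = u, OF fin] y(1) by simp
        ultimately show "w (Suc n) x \<le> bousch f \<psi> u x + e"
          using y(2) by (simp add: step)
      qed
      then show "u x \<le> bousch f \<psi> u x + e"
        by (rule up)
    qed
  qed
qed

theorem proposition6p4: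
  fixes \<A> :: "'a::topological_space chart set"
    and f :: "'a \<Rightarrow> 'a" and C :: "'a set" and d :: "'a \<Rightarrow> 'a \<Rightarrow> real"
    and \<alpha> C\<^sub>1 :: real and \<phi> :: "'a \<Rightarrow> real"
  assumes "oriented_sphere \<A>"
    and "Thurston_map \<A> f" and "expanding \<A> f"
    and "Jordan_curve C" and "post \<A> f \<subseteq> C"
    and "\<exists>m\<ge>1. (f ^^ m) ` C \<subseteq> C"
    and "visual_metric \<A> f d"
    and "0 < \<alpha>" and "\<alpha> \<le> 1"
    and "\<phi> \<in> Lip d \<alpha>"
    and "C\<^sub>1 > 1"
    and "\<forall>\<psi>\<in>Lip d \<alpha>. \<forall>u\<in>Lip d \<alpha>. \<forall>n\<ge>1.
           (bousch f \<psi> ^^ n) u \<in> Lip d \<alpha> \<and>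
           lip_seminorm d \<alpha> ((bousch f \<psi> ^^ n) u)
             \<le> C\<^sub>1 * (lip_seminorm d \<alpha> \<psi> + lip_seminorm d \<alpha> u)"
  shows "(\<forall>x. bousch_limsup f \<phi> x = ereal (u_fun f \<phi> x)) \<and>
    (\<forall>x. \<bar>u_fun f \<phi> x\<bar> \<le> 2 * C\<^sub>1 * lip_seminorm d \<alpha> \<phi> * diam d UNIV powr \<alpha>) \<and>
    u_fun f \<phi> \<in> Lip d \<alpha> \<and>
    lip_seminorm d \<alpha> (u_fun f \<phi>) \<le> C\<^sub>1 * lip_seminorm d \<alpha> \<phi> \<and>
    bousch f (normalised f \<phi>) (u_fun f \<phi>) = u_fun f \<phi>"
proof -
  have bc: "branched_covering \<A> f"
    using assms(2) by (simp add: Thurston_map_def)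
  obtain h g where hg: "homeomorphism (UNIV :: 'a set) (sphere (0 :: real^3) 1) h g"
    using assms(1) by (rule oriented_sphere_homeomorphism)
  note top = sphere_homeomorphism_imp[OF hg]
  have f: "continuous_on UNIV f"
    using bc by (simp add: branched_covering_def)
  have fin: "finite (f -` {x})" for x
    by (rule branched_covering_finite_fibre[OF bc top(1,3)])
  have surj: "surj f"
    by (rule open_map_surj[OF top f]) (use branched_covering_open_map[OF bc, of UNIV] in simp)
  have \<phi>: "continuous_on UNIV \<phi>"
    by (rule Lip_continuous[OF assms(1) bc assms(7,8,10)])
  have ms: "Metric_space UNIV d"
    using visual_metric_tiles[OF assms(7)] by metis
  interpret Metric_space UNIV d
    by (rule ms)
  \<comment> \<open>the seminorm of \<open>0\<close> is \<open>0\<close> only because the set of difference quotients is nonempty\<close>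
  have two: "\<exists>x y::'a. x \<noteq> y"
  proof -
    define v :: "real^3" where "v = axis 1 1"
    have "v \<in> sphere 0 1" "- v \<in> sphere 0 1"
      by (simp_all add: v_def norm_axis_1)
    then obtain x y where xy: "h x = v" "h y = - v"
      using homeomorphism_image1[OF hg] by (metis imageE)
    have "v $ 1 \<noteq> (- v) $ 1"
      by (simp add: v_def axis_def)
    then have "h x \<noteq> h y"
      using xy by metis
    then have "x \<noteq> y"
      by (rule contrapos_nn) (rule arg_cong)
    then show ?thesis
      by (intro exI)
  qed
  define L where "L = lip_seminorm d \<alpha> \<phi>"
  define D where "D = diam d UNIV"
  define w where "w n = (bousch f (normalised f \<phi>) ^^ n) (\<lambda>_. 0)" for n
  \<comment> \<open>subtracting a constant leaves all difference quotients unchanged\<close>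
  have quot: "difference_quotients d \<alpha> (normalised f \<phi>) = difference_quotients d \<alpha> \<phi>"
    by (simp add: difference_quotients_def normalised_def)
  have "normalised f \<phi> \<in> Lip d \<alpha>" "lip_seminorm d \<alpha> (normalised f \<phi>) = L"
    using assms(10) by (simp_all add: Lip_def lip_seminorm_def L_def quot)
  moreover have zero: "(\<lambda>_. 0) \<in> Lip d \<alpha>" "lip_seminorm d \<alpha> (\<lambda>_. 0) \<le> 0"
    using Lip_intro[where \<psi> = "\<lambda>_. 0" and L = 0 and \<alpha> = \<alpha>, OF ms two] by simp_all
  ultimately have w: "w n \<in> Lip d \<alpha>" "lip_seminorm d \<alpha> (w n) \<le> C\<^sub>1 * L" if "n \<ge> 1" for n
  proof -
    have "w n \<in> Lip d \<alpha> \<and> lip_seminorm d \<alpha> (w n)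
        \<le> C\<^sub>1 * (lip_seminorm d \<alpha> (normalised f \<phi>) + lip_seminorm d \<alpha> (\<lambda>_. 0))"
      unfolding w_def using assms(12) \<open>normalised f \<phi> \<in> Lip d \<alpha>\<close> zero(1) that by blast
    moreover have "C\<^sub>1 * (lip_seminorm d \<alpha> (normalised f \<phi>) + lip_seminorm d \<alpha> (\<lambda>_. 0)) \<le> C\<^sub>1 * L"
      using \<open>lip_seminorm d \<alpha> (normalised f \<phi>) = L\<close> zero(2) assms(11) by simp
    ultimately show "w n \<in> Lip d \<alpha>" "lip_seminorm d \<alpha> (w n) \<le> C\<^sub>1 * L"
      by simp_all
  qed
  have w_lip: "\<bar>w n x - w n y\<bar> \<le> C\<^sub>1 * L * d x y powr \<alpha>" if "n \<ge> 1" for n x y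
    using order_trans[OF Lip_bound[OF ms w(1)[OF that]] mult_right_mono[OF w(2)[OF that]]] by simp
  have d_le: "d x y \<le> D" for x y
    unfolding D_def diam_def
    using visual_metric_bounded[OF assms(1) bc assms(7)] by (intro cSup_upper) auto
  have "L \<ge> 0"
  proof -
    obtain x y :: 'a where "x \<noteq> y"
      using two by blast
    then have "d x y powr \<alpha> > 0"
      using mdist_pos_less[of x y] by simp
    moreover have "0 \<le> L * d x y powr \<alpha>"
      using order_trans[OF abs_ge_zero Lip_bound[OF ms assms(10)]] by (simp add: L_def)
    ultimately show ?thesis
      by (simp add: zero_le_mult_iff)
  qed
  define B where "B = C\<^sub>1 * L * D powr \<alpha>"
  have "B \<ge> 0"
    using \<open>L \<ge> 0\<close> assms(11) by (simp add: B_def)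
  have osc: "\<bar>w n x - w n y\<bar> \<le> B" if "n \<ge> 1" for n x y
  proof -
    have "d x y powr \<alpha> \<le> D powr \<alpha>"
      using d_le assms(8) by (intro powr_mono2) auto
    then have "C\<^sub>1 * L * d x y powr \<alpha> \<le> B"
      unfolding B_def using \<open>L \<ge> 0\<close> assms(11) by (intro mult_left_mono) auto
    with w_lip[OF that, of x y] show ?thesis
      by linarith
  qed
  have w_bound: "\<bar>w n x\<bar> \<le> B" if n: "n \<ge> 1" for n x
  proof -
    obtain y where "0 \<le> w n y"
      using bousch_iterates_nonneg_somewhere[OF hg f \<phi> fin] unfolding w_def by blast
    then have "- B \<le> w n x"
      using osc[OF n, of x y] by linarith
    moreover have "w n x \<le> B"
    proof (rule field_le_epsilon)
      fix e :: real assume "e > 0"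
      then obtain z where "w n z \<le> e"
        using bousch_iterates_small_somewhere[OF hg f \<phi> fin surj n] unfolding w_def by blast
      then show "w n x \<le> B + e"
        using osc[OF n, of x z] by linarith
    qed
    ultimately show ?thesis
      by linarith
  qed
  have ev1: "\<forall>\<^sub>F n in sequentially. n \<ge> (1::nat)"
    by (rule eventually_ge_at_top)
  have up: "bousch_limsup f \<phi> x \<le> ereal B" for x
    unfolding bousch_limsup_def w_def[symmetric]
  proof (rule Limsup_bounded, rule eventually_mono[OF ev1])
    show "ereal (w n x) \<le> ereal B" if "n \<ge> 1" for n
      using w_bound[OF that, of x] by simp
  qed
  have low: "ereal (- B) \<le> bousch_limsup f \<phi> x" for x
    unfolding bousch_limsup_def w_def[symmetric]
  proof (rule order_trans[OF _ Liminf_le_Limsup])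
    show "ereal (- B) \<le> liminf (\<lambda>n. ereal (w n x))"
    proof (rule Liminf_bounded, rule eventually_mono[OF ev1])
      show "ereal (- B) \<le> ereal (w n x)" if "n \<ge> 1" for n
        using w_bound[OF that, of x] by simp
    qed
  qed simp
  have lim: "bousch_limsup f \<phi> x = ereal (u_fun f \<phi> x)" for x
    using up[of x] low[of x] unfolding u_fun_def
    by (cases "bousch_limsup f \<phi> x") auto
  have u_bound: "\<bar>u_fun f \<phi> x\<bar> \<le> B" for x
    using up[of x] low[of x] unfolding lim by (simp add: abs_le_iff)
  have u_diff: "u_fun f \<phi> x \<le> u_fun f \<phi> y + C\<^sub>1 * L * d x y powr \<alpha>" for x y
  proof (rule field_le_epsilon)
    fix e :: real assume "e > 0"
    then have "limsup (\<lambda>n. ereal (w n y)) < ereal (u_fun f \<phi> y + e)"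
      using lim[of y] by (simp add: bousch_limsup_def w_def)
    then have "\<forall>\<^sub>F n in sequentially. ereal (w n y) < ereal (u_fun f \<phi> y + e)"
      by (rule Limsup_lessD)
    with ev1 have "\<forall>\<^sub>F n in sequentially.
        ereal (w n x) \<le> ereal (u_fun f \<phi> y + C\<^sub>1 * L * d x y powr \<alpha> + e)"
    proof eventually_elim
      case (elim n)
      then show ?case
        using w_lip[of n x y] by simp
    qed
    then have "limsup (\<lambda>n. ereal (w n x)) \<le> ereal (u_fun f \<phi> y + C\<^sub>1 * L * d x y powr \<alpha> + e)"
      by (rule Limsup_bounded)
    then show "u_fun f \<phi> x \<le> u_fun f \<phi> y + C\<^sub>1 * L * d x y powr \<alpha> + e"
      using lim[of x] by (simp add: bousch_limsup_def w_def)
  qed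
  have "\<bar>u_fun f \<phi> x - u_fun f \<phi> y\<bar> \<le> C\<^sub>1 * L * d x y powr \<alpha>" for x y
    using u_diff[of x y] u_diff[of y x] by (simp add: commute abs_le_iff)
  note u_lip = Lip_intro[OF ms two this]
  have "bousch f (normalised f \<phi>) (u_fun f \<phi>) = u_fun f \<phi>"
    using lim by (intro bousch_fixed_point_of_limsup[where v = "\<lambda>_. 0", OF fin surj])
      (simp add: bousch_limsup_def)
  moreover have "B \<le> 2 * C\<^sub>1 * L * D powr \<alpha>"
    using \<open>B \<ge> 0\<close> by (simp add: B_def)
  ultimately show ?thesis
    using lim order_trans[OF u_bound] u_lip by (simp add: L_def D_def)
qed

end
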